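(* Let $d$ be a fixed dimension and let $f_1,\dots,f_d:\mathbb R\to\mathbb R$ be smooth functions such that, for each $i$, $|f_i^{(a)}(0)|\le C_iK_i^a$ for all integers $a\ge0$, for some finite constants $C_i,K_i$. Let $\bm\Gamma_\rho=\bm I+\bm B$ be a $d\times d$ real symmetric matrix with $\|\bm B\|\le\delta<1/2$ and $B_{ii}=0$ for each $i$, and set $\epsilon:=\frac{\delta}{1-\delta}$. Let $\bm X=(X_1,\dots,X_d)\sim\mathcal N(\bm 0,\bm\Gamma_\rho^{-1})$, let $\bm Z=(f_1(X_1),\dots,f_d(X_d))$, and let $\bm\Sigma_\pi$ be the covariance matrix of $\bm Z$. Then \[\bm\Sigma_\pi=\mathrm K\,\bm I-\bm\Lambda\bm B\bm\Lambda+\bm E',\] where $\mathrm K:=\operatorname{diag}(\kappa_1,\dots,\kappa_d)$ with $\kappa_i:=\sum_{k\ge1}\frac{F_{ki}(1/2)^2}{k!}$, $\bm\Lambda:=\operatorname{diag}(\lambda_1,\dots,\lambda_d)$ with $\lambda_i:=F_{1i}(1/2)$, and $\|\bm E'\|=\mathcal O(\epsilon^2)$, with implied constant depending only on $d$ and $f_1,\dots,f_d$.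
   Context: $\|\bm A\|$ denotes the operator norm of a matrix with respect to the Euclidean norm. For $f_i$ satisfying the derivative condition and an integer $k\ge0$, $F_{ki}(x):=\sum_{u\ge0}\frac{f_i^{(2u+k)}(0)}{u!}x^u$ (a power series with infinite radius of convergence).
   Formalization: Each f_i is additionally assumed to equal its Maclaurin series at every real x; smoothness with the derivative bound at 0 alone is not enough, e.g. f(x)=exp(-1/x^2), f(0)=0, has κ=λ=0 but positive variance when B=0 and δ=0. *)

theory Defs
  imports "HOL-Analysis.Analysis" "HOL-Probability.Probability"
begin

definition hderiv :: "nat \<Rightarrow> (real \<Rightarrow> real) \<Rightarrow> real \<Rightarrow> real" where
  "hderiv a g = (deriv ^^ a) g"

definition smooth_fun :: "(real \<Rightarrow> real) \<Rightarrow> bool" where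
  "smooth_fun g \<longleftrightarrow> (\<forall>a x. hderiv a g differentiable (at x))"

definition Fser :: "(real \<Rightarrow> real) \<Rightarrow> nat \<Rightarrow> real \<Rightarrow> real" where
  "Fser g k x = (\<Sum>u. hderiv (2*u+k) g 0 / fact u * x ^ u)"

definition kappa :: "(real \<Rightarrow> real) \<Rightarrow> real" where
  "kappa g = (\<Sum>k. (Fser g (Suc k) (1/2))\<^sup>2 / fact (Suc k))"

definition lambda :: "(real \<Rightarrow> real) \<Rightarrow> real" where
  "lambda g = Fser g 1 (1/2)"

definition diag_mat :: "('n::finite \<Rightarrow> real) \<Rightarrow> real^'n^'n" where
  "diag_mat v = (\<chi> i j. if i = j then v i else 0)"

definition opnorm :: "real^'n^'m \<Rightarrow> real" where
  "opnorm A = onorm (\<lambda>x. A *v x)"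

text \<open>Density of N(0, P^{-1}) on R^n, P the precision matrix (positive definite).\<close>
definition gauss_prec_density :: "real^'n^'n \<Rightarrow> real^'n \<Rightarrow> real" where
  "gauss_prec_density P x =
     (2 * pi) powr (- real CARD('n) / 2) * sqrt (det P) * exp (- (x \<bullet> (P *v x)) / 2)"

definition gauss_prec :: "real^'n^'n \<Rightarrow> (real^'n) measure" where
  "gauss_prec P = density lborel (\<lambda>x. ennreal (gauss_prec_density P x))"

definition cov_transformed :: "real^'n^'n \<Rightarrow> ('n \<Rightarrow> real \<Rightarrow> real) \<Rightarrow> real^'n^'n" where
  "cov_transformed P f = (\<chi> i j.
      (\<integral>x. f i (x$i) * f j (x$j) \<partial>gauss_prec P)
      - (\<integral>x. f i (x$i) \<partial>gauss_prec P) * (\<integral>x. f j (x$j) \<partial>gauss_prec P))"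

end

theory Submission
  imports Defs
begin

text \<open>Let \<open>\<Gamma> = (1 + B)\<^bsup>-1\<^esup>\<close>. Completing the square gives the moment generating function of a pair
  \<open>(X\<^sub>i, X\<^sub>j)\<close> as a Gaussian in the entries of \<open>\<Gamma>\<close>; comparing coefficients of double power series gives
  all mixed moments, and resumming the Taylor series of \<open>f\<^sub>i\<close> and \<open>f\<^sub>j\<close> yields
  \<open>Cov (f\<^sub>i X\<^sub>i) (f\<^sub>j X\<^sub>j) = (\<Sum>k\<ge>1. \<Gamma>\<^sub>i\<^sub>j ^ k / k! * F\<^sub>k\<^sub>i (\<Gamma>\<^sub>i\<^sub>i / 2) * F\<^sub>k\<^sub>j (\<Gamma>\<^sub>j\<^sub>j / 2))\<close>.
  By the Neumann expansion \<open>\<Gamma> = 1 - B + O(\<delta>\<^sup>2)\<close> entrywise, so diagonal entries are \<open>\<kappa>\<^sub>i + O(\<delta>\<^sup>2)\<close>, and off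
  the diagonal the term \<open>k = 1\<close> contributes \<open>- \<lambda>\<^sub>i B\<^sub>i\<^sub>j \<lambda>\<^sub>j + O(\<delta>\<^sup>2)\<close> while the others are \<open>O(\<delta>\<^sup>2)\<close>.

  The normalisation \<open>(\<integral> exp (- x \<bullet> P x / 2))\<^sup>2 * det P = (2 \<pi>)\<^sup>n\<close> is obtained without a linear change of
  variables: along \<open>P = 1 + s B\<close> the left-hand side has derivative \<open>0\<close>, because the logarithmic derivatives
  of the integral and of the determinant are \<open>- tr (P\<^bsup>-1\<^esup> B) / 2\<close> and \<open>tr (P\<^bsup>-1\<^esup> B)\<close>.\<close>

section \<open>Expectations of entire functions of a Gaussian pair\<close>

text \<open>Strong induction: with the lower coefficients gone, dividing by \<open>x ^ n\<close>
  leaves a power series that is 0 off the origin and tends to \<open>a n\<close> there.\<close>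

lemma powser_zero_imp_coeff_zero:
  fixes a :: "nat \<Rightarrow> real"
  assumes "\<And>x. (\<lambda>n. a n * x ^ n) sums 0"
  shows "a n = 0"
proof (induction n rule: less_induct)
  case (less n)
  have "(\<lambda>m. a (m + n) * x ^ m) sums 0" if "x \<noteq> 0" for x
  proof -
    have "(\<lambda>m. a (m + n) * x ^ (m + n)) sums (0 - (\<Sum>i<n. a i * x ^ i))"
      using assms[of x] by (rule sums_split_initial_segment)
    also have "(\<Sum>i<n. a i * x ^ i) = 0" using less by simp
    finally have "(\<lambda>m. a (m + n) * x ^ (m + n)) sums 0" by simp
    then have "(\<lambda>m. a (m + n) * x ^ (m + n) * inverse (x ^ n)) sums (0 * inverse (x ^ n))"
      by (rule sums_mult2)
    then show ?thesis using that by (simp add: power_add mult.assoc)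
  qed
  then have "((\<lambda>_. 0) \<longlongrightarrow> a (0 + n)) (at (0::real))"
    by (rule powser_limit_0_strong[OF zero_less_one])
  then show ?case by (simp add: tendsto_const_iff)
qed

text \<open>Summing over \<open>n\<close> first gives a power series in \<open>s\<close> with
  coefficients \<open>g m t\<close>; the one-variable case applies in \<open>s\<close> and then in
  \<open>t\<close>.\<close>

lemma double_powser_zero_imp_coeff_zero:
  fixes c :: "nat \<times> nat \<Rightarrow> real"
  assumes "\<And>s t. ((\<lambda>(m, n). c (m, n) * s ^ m * t ^ n) has_sum 0) UNIV"
  shows "c (m, n) = 0"
proof -
  \<comment> \<open>Summability in \<open>n\<close> is read off at \<open>s = 1\<close>, where the
    factor \<open>s ^ m\<close> cannot vanish.\<close>
  have inner: "(\<lambda>n. c (m, n) * t ^ n) summable_on UNIV" for m t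
    using summable_on_SigmaD1[of "\<lambda>m n. c (m, n) * 1 ^ m * t ^ n" UNIV "\<lambda>_. UNIV" m]
      assms[of 1 t] by (auto simp: has_sum_iff)
  define g where "g m t = (\<Sum>\<^sub>\<infinity>n. c (m, n) * t ^ n)" for m t
  have g: "((\<lambda>n. c (m, n) * t ^ n) has_sum g m t) UNIV" for m t
    using inner by (simp add: g_def)
  have "((\<lambda>m. g m t * s ^ m) has_sum 0) UNIV" for s t
  proof (rule has_sum_SigmaD)
    show "((\<lambda>(m, n). c (m, n) * s ^ m * t ^ n) has_sum 0) (UNIV \<times> UNIV)"
      using assms by simp
    show "((\<lambda>n. (case (m, n) of (m, n) \<Rightarrow> c (m, n) * s ^ m * t ^ n)) has_sum g m t * s ^ m) UNIV" for m
      using has_sum_cmult_left[OF g[of m t], of "s ^ m"] by (simp add: mult_ac)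
  qed
  then have "g m t = 0" for m t
    by (intro powser_zero_imp_coeff_zero[of "\<lambda>m. g m t"] has_sum_imp_sums)
  then show ?thesis
    using g by (intro powser_zero_imp_coeff_zero[of "\<lambda>n. c (m, n)"] has_sum_imp_sums) metis
qed

section \<open>Termwise integration of products of power series\<close>

text \<open>Lets an unconditional sum over pairs be evaluated along squares, where a sum of products
  factors into one-variable partial sums.\<close>

lemma filterlim_boxes_finite_subsets_at_top:
  "filterlim (\<lambda>N. {..<N} \<times> {..<N}) (finite_subsets_at_top (UNIV :: (nat \<times> nat) set)) sequentially"
  unfolding filterlim_finite_subsets_at_top
proof (intro allI impI)
  fix Y :: "(nat \<times> nat) set" assume "finite Y \<and> Y \<subseteq> UNIV"
  then have fin: "finite (fst ` Y \<union> snd ` Y)" by simp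
  show "\<forall>\<^sub>F N in sequentially. finite ({..<N} \<times> {..<N}) \<and> Y \<subseteq> {..<N} \<times> {..<N} \<and> {..<N} \<times> {..<N} \<subseteq> UNIV"
    using eventually_gt_at_top[of "Max (fst ` Y \<union> snd ` Y)"]
  proof eventually_elim
    case (elim N)
    have "fst p < N \<and> snd p < N" if "p \<in> Y" for p
      using Max_ge[OF fin, of "fst p"] Max_ge[OF fin, of "snd p"] elim that
      by (auto intro: le_less_trans)
    then show ?case by fastforce
  qed
qed

text \<open>Comparison with the exponential series. The second bound is uniform in \<open>N\<close>
  and supplies the dominating function for the integrals below.\<close>

lemma exp_type_abs_summable:
  fixes \<alpha> :: "nat \<Rightarrow> real"
  assumes "\<And>m. \<bar>\<alpha> m\<bar> \<le> C * K ^ m"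
  shows "summable (\<lambda>m. \<bar>\<alpha> m / fact m * x ^ m\<bar>)" "(\<Sum>m<N. \<bar>\<alpha> m / fact m * x ^ m\<bar>) \<le> C * exp (K * \<bar>x\<bar>)"
proof -
  have e: "(\<lambda>m. C * ((K * \<bar>x\<bar>) ^ m / fact m)) sums (C * exp (K * \<bar>x\<bar>))"
    using exp_converges[of "K * \<bar>x\<bar>"] by (intro sums_mult) (simp add: field_simps)
  have le: "\<bar>\<alpha> m / fact m * x ^ m\<bar> \<le> C * ((K * \<bar>x\<bar>) ^ m / fact m)" for m
    using mult_right_mono[OF assms[of m], of "\<bar>x\<bar> ^ m / fact m"]
    by (simp add: abs_mult power_abs power_mult_distrib mult_ac)
  show s: "summable (\<lambda>m. \<bar>\<alpha> m / fact m * x ^ m\<bar>)"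
    by (rule summable_comparison_test'[OF sums_summable[OF e]]) (use le in simp)
  have "(\<Sum>m<N. \<bar>\<alpha> m / fact m * x ^ m\<bar>) \<le> (\<Sum>m. \<bar>\<alpha> m / fact m * x ^ m\<bar>)"
    by (rule sum_le_suminf[OF s]) auto
  also have "\<dots> \<le> (\<Sum>m. C * ((K * \<bar>x\<bar>) ^ m / fact m))"
    by (rule suminf_le[OF le s sums_summable[OF e]])
  finally show "(\<Sum>m<N. \<bar>\<alpha> m / fact m * x ^ m\<bar>) \<le> C * exp (K * \<bar>x\<bar>)"
    using sums_unique[OF e] by simp
qed

text \<open>Dominated convergence along square partial sums, with one majorant \<open>W\<close> for
  all of them. The same \<open>W\<close> controls the absolute values, which turns the limit along
  squares into an unconditional sum.\<close>

lemma moment_double_series: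
  fixes X Y :: "'a \<Rightarrow> real" and \<alpha> \<beta> :: "nat \<Rightarrow> real"
  assumes X [measurable]: "X \<in> borel_measurable N" and Y [measurable]: "Y \<in> borel_measurable N"
    and int: "\<And>s t. integrable N (\<lambda>w. exp (s * X w + t * Y w))"
    and \<alpha>: "\<And>m. \<bar>\<alpha> m\<bar> \<le> C * K ^ m" and \<beta>: "\<And>n. \<bar>\<beta> n\<bar> \<le> C * K ^ n"
    and F: "\<And>x. (\<lambda>m. \<alpha> m / fact m * x ^ m) sums F x"
    and G: "\<And>x. (\<lambda>n. \<beta> n / fact n * x ^ n) sums G x"
  shows "((\<lambda>(m, n). \<alpha> m * \<beta> n * (\<integral>w. X w ^ m / fact m * (Y w ^ n / fact n) \<partial>N))
           has_sum (\<integral>w. F (X w) * G (Y w) \<partial>N)) UNIV"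
    and "integrable N (\<lambda>w. F (X w) * G (Y w))"
proof -
  have C: "C \<ge> 0" using \<alpha>[of 0] by simp
  define W where "W w = C * exp (K * \<bar>X w\<bar>) * (C * exp (K * \<bar>Y w\<bar>))" for w
  have intW: "integrable N W"
  proof (rule Bochner_Integration.integrable_bound)
    show "integrable N (\<lambda>w. C * C * (exp (K * X w + K * Y w) + exp (K * X w + (-K) * Y w)
        + exp ((-K) * X w + K * Y w) + exp ((-K) * X w + (-K) * Y w)))"
      by (intro integrable_mult_right Bochner_Integration.integrable_add int)
    have "norm (W w) \<le> C * C * (exp (K * X w + K * Y w) + exp (K * X w + (-K) * Y w)
        + exp ((-K) * X w + K * Y w) + exp ((-K) * X w + (-K) * Y w))" for w
    proof -
      have "norm (W w) = C * C * exp (K * \<bar>X w\<bar> + K * \<bar>Y w\<bar>)"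
        using C by (simp add: W_def exp_add mult_ac abs_mult)
      \<comment> \<open>Each absolute value is attained by a choice of sign, so the left side is one
        of the four summands.\<close>
      moreover have "exp (K * \<bar>X w\<bar> + K * \<bar>Y w\<bar>) \<le> exp (K * X w + K * Y w) + exp (K * X w + (-K) * Y w)
        + exp ((-K) * X w + K * Y w) + exp ((-K) * X w + (-K) * Y w)"
        by (cases "X w \<ge> 0"; cases "Y w \<ge> 0") (auto intro: add_increasing add_increasing2)
      ultimately show ?thesis using C by (simp only:) (rule mult_left_mono, auto)
    qed
    then show "AE w in N. norm (W w) \<le> norm (C * C * (exp (K * X w + K * Y w) + exp (K * X w + (-K) * Y w)
        + exp ((-K) * X w + K * Y w) + exp ((-K) * X w + (-K) * Y w)))"
      by (intro always_eventually allI) (smt (verit) real_norm_def)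
    show "W \<in> borel_measurable N" unfolding W_def by measurable
  qed
  define a where "a m w = \<alpha> m / fact m * X w ^ m" for m w
  define b where "b n w = \<beta> n / fact n * Y w ^ n" for n w
  have [measurable]: "a m \<in> borel_measurable N" "b n \<in> borel_measurable N" for m n
    unfolding a_def b_def by measurable
  have abs_box: "(\<Sum>(m,n)\<in>{..<M}\<times>{..<M}. \<bar>a m w * b n w\<bar>) \<le> W w" for M w
  proof -
    have "(\<Sum>(m,n)\<in>{..<M}\<times>{..<M}. \<bar>a m w * b n w\<bar>) = (\<Sum>m<M. \<bar>a m w\<bar>) * (\<Sum>n<M. \<bar>b n w\<bar>)"
      by (simp add: sum_product sum.cartesian_product abs_mult)
    also have "\<dots> \<le> W w" unfolding W_def a_def b_def
      by (intro mult_mono exp_type_abs_summable \<alpha> \<beta> sum_nonneg) (use C in auto)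
    finally show ?thesis .
  qed
  have single: "\<bar>a m w * b n w\<bar> \<le> W w" for m n w
  proof -
    have "\<bar>a m w * b n w\<bar> = (\<Sum>(m,n)\<in>{(m,n)}. \<bar>a m w * b n w\<bar>)" by simp
    also have "\<dots> \<le> (\<Sum>(m,n)\<in>{..<Suc (max m n)}\<times>{..<Suc (max m n)}. \<bar>a m w * b n w\<bar>)"
      by (rule sum_mono2) auto
    finally show ?thesis using abs_box[of _ "Suc (max m n)"] order_trans by blast
  qed
  have intab: "integrable N (\<lambda>w. a m w * b n w)" for m n
    by (rule Bochner_Integration.integrable_bound[OF intW])
       (auto intro!: always_eventually order_trans[OF single])
  define T where "T = (\<lambda>(m,n). \<integral>w. a m w * b n w \<partial>N)"
  have box_int: "(\<Sum>p\<in>{..<M}\<times>{..<M}. T p) = (\<integral>w. (\<Sum>m<M. a m w) * (\<Sum>n<M. b n w) \<partial>N)" for M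
    by (simp add: T_def sum_product sum.cartesian_product case_prod_unfold intab)
  have lim: "(\<lambda>M. (\<Sum>m<M. a m w) * (\<Sum>n<M. b n w)) \<longlonglongrightarrow> F (X w) * G (Y w)" for w
    using F[of "X w"] G[of "Y w"] unfolding sums_def a_def b_def by (rule tendsto_mult)
  have FG [measurable]: "(\<lambda>w. F (X w) * G (Y w)) \<in> borel_measurable N"
    by (rule borel_measurable_LIMSEQ_real[OF lim]) measurable
  have bnd: "norm ((\<Sum>m<M. a m w) * (\<Sum>n<M. b n w)) \<le> W w" for M w
  proof -
    have "norm ((\<Sum>m<M. a m w) * (\<Sum>n<M. b n w)) = \<bar>\<Sum>(m,n)\<in>{..<M}\<times>{..<M}. a m w * b n w\<bar>"
      by (simp add: sum_product sum.cartesian_product)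
    also have "\<dots> \<le> (\<Sum>(m,n)\<in>{..<M}\<times>{..<M}. \<bar>a m w * b n w\<bar>)"
      by (rule order_trans[OF sum_abs]) (simp add: case_prod_unfold)
    finally show ?thesis using abs_box order_trans by blast
  qed
  have dct: "(\<lambda>M. \<integral>w. (\<Sum>m<M. a m w) * (\<Sum>n<M. b n w) \<partial>N) \<longlonglongrightarrow> (\<integral>w. F (X w) * G (Y w) \<partial>N)"
    by (rule integral_dominated_convergence[OF FG _ intW]) (use lim bnd in auto)
  show "integrable N (\<lambda>w. F (X w) * G (Y w))"
    by (rule integrable_dominated_convergence[where s = "\<lambda>M w. (\<Sum>m<M. a m w) * (\<Sum>n<M. b n w)", OF FG _ intW])
       (use lim bnd in auto)
  \<comment> \<open>Every finite index set lies in a square, so its absolute sum is at most the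
    integral of \<open>W\<close>.\<close>
  have "(\<lambda>p. norm (T p)) summable_on UNIV"
  proof (rule nonneg_bdd_above_summable_on)
    show "bdd_above (sum (\<lambda>p. norm (T p)) ` {F. F \<subseteq> UNIV \<and> finite F})"
    proof (rule bdd_aboveI2)
      fix A :: "(nat \<times> nat) set" assume "A \<in> {F. F \<subseteq> UNIV \<and> finite F}"
      then have A: "finite A" by simp
      have "\<forall>\<^sub>F M in sequentially. A \<subseteq> {..<M} \<times> {..<M}"
        using filterlim_boxes_finite_subsets_at_top A
        unfolding filterlim_finite_subsets_at_top by (auto elim: eventually_mono)
      then obtain M where M: "A \<subseteq> {..<M} \<times> {..<M}" by (auto simp: eventually_sequentially)
      have "sum (\<lambda>p. norm (T p)) A \<le> (\<Sum>p\<in>{..<M} \<times> {..<M}. norm (T p))"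
        using M by (intro sum_mono2) auto
      also have "\<dots> \<le> (\<Sum>(m,n)\<in>{..<M} \<times> {..<M}. \<integral>w. \<bar>a m w * b n w\<bar> \<partial>N)"
        unfolding T_def by (intro sum_mono) (auto intro: integral_abs_bound)
      also have "\<dots> = (\<integral>w. (\<Sum>(m,n)\<in>{..<M} \<times> {..<M}. \<bar>a m w * b n w\<bar>) \<partial>N)"
        by (simp add: case_prod_unfold integrable_abs intab)
      also have "\<dots> \<le> (\<integral>w. W w \<partial>N)"
        by (rule integral_mono[OF _ intW])
           (auto simp: case_prod_unfold intro!: integrable_abs intab abs_box[unfolded case_prod_unfold])
      finally show "sum (\<lambda>p. norm (T p)) A \<le> (\<integral>w. W w \<partial>N)" .
    qed
  qed auto
  then have "(T has_sum infsum T UNIV) UNIV"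
    using abs_summable_summable by (intro has_sum_infsum)
  \<comment> \<open>The unconditional sum is also the limit along squares, and dominated convergence
    has identified that limit.\<close>
  then have "(\<lambda>M. sum T ({..<M} \<times> {..<M})) \<longlonglongrightarrow> infsum T UNIV"
    unfolding has_sum_def by (rule filterlim_compose[OF _ filterlim_boxes_finite_subsets_at_top])
  then have "infsum T UNIV = (\<integral>w. F (X w) * G (Y w) \<partial>N)"
    unfolding box_int by (rule LIMSEQ_unique[OF _ dct])
  with \<open>(T has_sum infsum T UNIV) UNIV\<close> have *: "(T has_sum (\<integral>w. F (X w) * G (Y w) \<partial>N)) UNIV"
    by simp
  have "a m w * b n w = \<alpha> m * \<beta> n * (X w ^ m / fact m * (Y w ^ n / fact n))" for m n w
    by (simp add: a_def b_def)
  then have "T = (\<lambda>(m, n). \<alpha> m * \<beta> n * (\<integral>w. X w ^ m / fact m * (Y w ^ n / fact n) \<partial>N))"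
    unfolding T_def by simp
  with * show "((\<lambda>(m, n). \<alpha> m * \<beta> n * (\<integral>w. X w ^ m / fact m * (Y w ^ n / fact n) \<partial>N))
           has_sum (\<integral>w. F (X w) * G (Y w) \<partial>N)) UNIV" by simp
qed

section \<open>Regrouping of absolutely summable families\<close>

lemma has_sum_product_real:
  fixes f :: "'a \<Rightarrow> real" and g :: "'b \<Rightarrow> real"
  assumes f: "(f has_sum x) A" and g: "(g has_sum y) B"
  shows "((\<lambda>(u, v). f u * g v) has_sum x * y) (A \<times> B)"
proof -
  have 1: "(\<lambda>u. norm (f u)) summable_on A" and 2: "(\<lambda>v. norm (g v)) summable_on B"
    using f g by (metis has_sum_imp_summable summable_on_iff_abs_summable_on_real)+
  have "(\<lambda>(u, v). norm (f u) * norm (g v)) summable_on A \<times> B"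
    by (rule summable_on_SigmaI[where g = "\<lambda>u. norm (f u) * infsum (\<lambda>v. norm (g v)) B"])
       (use 1 2 in \<open>auto intro!: has_sum_cmult_right summable_on_cmult_left\<close>)
  also have "(\<lambda>(u, v). norm (f u) * norm (g v)) = (\<lambda>p. norm (case p of (u, v) \<Rightarrow> f u * g v))"
    by (auto simp: abs_mult)
  finally have "(\<lambda>(u, v). f u * g v) summable_on A \<times> B"
    by (rule abs_summable_summable)
  then show ?thesis
    by (rule has_sum_SigmaI[rotated 2])
       (use f g in \<open>auto intro!: has_sum_cmult_right has_sum_cmult_left\<close>)
qed

lemma exp_has_sum_real: "((\<lambda>k. x ^ k / fact k) has_sum exp x) (UNIV :: nat set)" for x :: real
proof -
  have "(\<lambda>k. norm (x ^ k / fact k)) sums exp \<bar>x\<bar>"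
    using exp_converges[of "\<bar>x\<bar>"] by (simp add: power_abs field_simps)
  moreover have "(\<lambda>k. x ^ k / fact k) sums exp x"
    using exp_converges[of x] by (simp add: field_simps)
  ultimately show ?thesis
    by (intro norm_summable_imp_has_sum sums_summable)
qed

text \<open>This is \<open>Fser\<close> for an abstract coefficient sequence, so that besides
  derivatives at 0 it also accepts geometric sequences and the coefficients of a constant.\<close>

definition shifted_series :: "(nat \<Rightarrow> real) \<Rightarrow> nat \<Rightarrow> real \<Rightarrow> real" where
  "shifted_series \<alpha> k x = (\<Sum>u. \<alpha> (2 * u + k) / fact u * x ^ u)"

lemma exp_type_term_bound:
  fixes \<alpha> :: "nat \<Rightarrow> real"
  assumes "\<And>m. \<bar>\<alpha> m\<bar> \<le> C * K ^ m"
  shows "\<bar>\<alpha> (2 * u + k) / fact u * x ^ u\<bar> \<le> C * K ^ k * ((K\<^sup>2 * \<bar>x\<bar>) ^ u / fact u)"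
proof -
  have "\<bar>\<alpha> (2 * u + k) / fact u * x ^ u\<bar> = \<bar>\<alpha> (2 * u + k)\<bar> * (\<bar>x\<bar> ^ u / fact u)"
    by (simp add: abs_mult power_abs)
  also have "\<dots> \<le> (C * K ^ (2 * u + k)) * (\<bar>x\<bar> ^ u / fact u)"
    by (rule mult_right_mono[OF assms]) simp
  also have "K ^ (2 * u + k) = K ^ k * (K\<^sup>2) ^ u"
    by (simp add: power_add power_mult)
  finally show ?thesis
    by (simp add: power_mult_distrib mult_ac)
qed

lemma shifted_series_has_sum:
  fixes \<alpha> :: "nat \<Rightarrow> real"
  assumes "\<And>m. \<bar>\<alpha> m\<bar> \<le> C * K ^ m"
  shows "((\<lambda>u. \<alpha> (2 * u + k) / fact u * x ^ u) has_sum shifted_series \<alpha> k x) UNIV"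
    and "\<bar>shifted_series \<alpha> k x\<bar> \<le> C * K ^ k * exp (K\<^sup>2 * \<bar>x\<bar>)"
proof -
  let ?g = "\<lambda>u. C * K ^ k * ((K\<^sup>2 * \<bar>x\<bar>) ^ u / fact u)"
  have g: "(?g has_sum (C * K ^ k * exp (K\<^sup>2 * \<bar>x\<bar>))) UNIV"
    by (intro has_sum_cmult_right exp_has_sum_real)
  have le: "norm (\<alpha> (2 * u + k) / fact u * x ^ u) \<le> ?g u" for u
    using exp_type_term_bound[OF assms] by simp
  have "(\<lambda>u. norm (\<alpha> (2 * u + k) / fact u * x ^ u)) summable_on UNIV"
    by (rule Infinite_Sum.abs_summable_on_comparison_test'[OF has_sum_imp_summable[OF g] le])
  then have "((\<lambda>u. \<alpha> (2 * u + k) / fact u * x ^ u) has_sum (\<Sum>\<^sub>\<infinity>u. \<alpha> (2 * u + k) / fact u * x ^ u)) UNIV"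
    by (rule has_sum_infsum[OF abs_summable_summable])
  moreover from this have "(\<Sum>\<^sub>\<infinity>u. \<alpha> (2 * u + k) / fact u * x ^ u) = shifted_series \<alpha> k x"
    unfolding shifted_series_def by (intro sums_unique has_sum_imp_sums)
  ultimately show *: "((\<lambda>u. \<alpha> (2 * u + k) / fact u * x ^ u) has_sum shifted_series \<alpha> k x) UNIV"
    by simp
  show "\<bar>shifted_series \<alpha> k x\<bar> \<le> C * K ^ k * exp (K\<^sup>2 * \<bar>x\<bar>)"
    using norm_infsum_le[OF * g] le by simp
qed

text \<open>The weights below, summed over the fiber of \<open>(m, n)\<close>, give the coefficient of \<open>s ^ m * t ^ n\<close>
  in \<open>exp (c * s * t + (a / 2) * s\<^sup>2 + (b / 2) * t\<^sup>2)\<close>.\<close>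
definition gauss_fiber :: "nat \<times> nat \<Rightarrow> (nat \<times> nat \<times> nat) set" where
  "gauss_fiber = (\<lambda>(m, n). {(k, p, q). 2 * p + k = m \<and> 2 * q + k = n})"

definition gauss_weight :: "real \<Rightarrow> real \<Rightarrow> real \<Rightarrow> nat \<times> nat \<times> nat \<Rightarrow> real" where
  "gauss_weight a b c = (\<lambda>(k, p, q). c ^ k / fact k * ((a / 2) ^ p / fact p * ((b / 2) ^ q / fact q)))"

lemma finite_gauss_fiber: "finite (gauss_fiber p)"
proof -
  obtain m n where p: "p = (m, n)" by (cases p)
  have "gauss_fiber p \<subseteq> {..m} \<times> {..m} \<times> {..n}"
    by (auto simp: gauss_fiber_def p)
  then show ?thesis by (rule finite_subset) auto
qed

text \<open>Two groupings of one absolutely summable family over triples \<open>(k, p, q)\<close>: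
  by \<open>k\<close> it factors into shifted series, by \<open>(2 * p + k, 2 * q + k)\<close> it
  becomes the moment series. \<open>S\<close> is the common value.\<close>

lemma gauss_weight_regroup:
  fixes \<alpha> \<beta> :: "nat \<Rightarrow> real"
  assumes \<alpha>: "\<And>m. \<bar>\<alpha> m\<bar> \<le> C * K ^ m" and \<beta>: "\<And>m. \<bar>\<beta> m\<bar> \<le> C * K ^ m" and K: "K \<ge> 0"
  shows "\<exists>S. ((\<lambda>(m, n). \<alpha> m * \<beta> n * sum (gauss_weight a b c) (gauss_fiber (m, n))) has_sum S) UNIV \<and>
    ((\<lambda>k. c ^ k / fact k * (shifted_series \<alpha> k (a / 2) * shifted_series \<beta> k (b / 2))) has_sum S) UNIV"
proof -
  have C: "C \<ge> 0" using \<alpha>[of 0] by simp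
  define h where "h = (\<lambda>(k, p, q). c ^ k / fact k *
    ((\<alpha> (2 * p + k) / fact p * (a / 2) ^ p) * (\<beta> (2 * q + k) / fact q * (b / 2) ^ q)))"
  let ?e = "\<lambda>x k. (K\<^sup>2 * \<bar>x\<bar>) ^ k / fact k"
  \<comment> \<open>The factors \<open>K ^ k\<close> coming from \<open>\<alpha>\<close> and from
    \<open>\<beta>\<close> combine to \<open>(K\<^sup>2) ^ k\<close>, so a product of three
    exponential series dominates up to \<open>C\<^sup>2\<close>.\<close>
  have dom: "((\<lambda>(k, r). ?e c k * (case r of (p, q) \<Rightarrow> ?e (a / 2) p * ?e (b / 2) q)) has_sum
     (exp (K\<^sup>2 * \<bar>c\<bar>) * (exp (K\<^sup>2 * \<bar>a / 2\<bar>) * exp (K\<^sup>2 * \<bar>b / 2\<bar>)))) (UNIV \<times> (UNIV \<times> UNIV))"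
    by (intro has_sum_product_real exp_has_sum_real)
  have "norm (h x) \<le> C\<^sup>2 * (case x of (k, r) \<Rightarrow> ?e c k * (case r of (p, q) \<Rightarrow> ?e (a / 2) p * ?e (b / 2) q))" for x
  proof -
    obtain k p q where x: "x = (k, p, q)" by (cases x)
    have "norm (h x) = \<bar>c\<bar> ^ k / fact k * (\<bar>\<alpha> (2 * p + k) / fact p * (a / 2) ^ p\<bar> * \<bar>\<beta> (2 * q + k) / fact q * (b / 2) ^ q\<bar>)"
      by (simp add: x h_def abs_mult power_abs)
    also have "\<dots> \<le> \<bar>c\<bar> ^ k / fact k * ((C * K ^ k * ?e (a / 2) p) * (C * K ^ k * ?e (b / 2) q))"
      by (intro mult_left_mono mult_mono exp_type_term_bound \<alpha> \<beta>) (use C K in auto)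
    finally show ?thesis
      by (simp add: x power2_eq_square power_mult_distrib mult_ac)
  qed
  then have "(\<lambda>x. norm (h x)) summable_on (UNIV \<times> (UNIV \<times> UNIV))"
    by (intro Infinite_Sum.abs_summable_on_comparison_test'[OF summable_on_cmult_right[OF has_sum_imp_summable[OF dom]]]) 
  then obtain S where S: "(h has_sum S) (UNIV \<times> (UNIV \<times> UNIV))"
    using abs_summable_summable summable_on_def by blast
  have 1: "((\<lambda>k. c ^ k / fact k * (shifted_series \<alpha> k (a / 2) * shifted_series \<beta> k (b / 2))) has_sum S) UNIV"
  proof (rule has_sum_SigmaD[OF S])
    fix k
    have "((\<lambda>(p, q). (\<alpha> (2 * p + k) / fact p * (a / 2) ^ p) * (\<beta> (2 * q + k) / fact q * (b / 2) ^ q)) has_sum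
      shifted_series \<alpha> k (a / 2) * shifted_series \<beta> k (b / 2)) (UNIV \<times> UNIV)"
      by (intro has_sum_product_real shifted_series_has_sum(1)[OF \<alpha>] shifted_series_has_sum(1)[OF \<beta>])
    then have "((\<lambda>r. c ^ k / fact k * (case r of (p, q) \<Rightarrow> (\<alpha> (2 * p + k) / fact p * (a / 2) ^ p) * (\<beta> (2 * q + k) / fact q * (b / 2) ^ q))) has_sum
      c ^ k / fact k * (shifted_series \<alpha> k (a / 2) * shifted_series \<beta> k (b / 2))) (UNIV \<times> UNIV)"
      by (rule has_sum_cmult_right)
    then show "((\<lambda>r. h (k, r)) has_sum
      c ^ k / fact k * (shifted_series \<alpha> k (a / 2) * shifted_series \<beta> k (b / 2))) (UNIV \<times> UNIV)"
      by (simp add: h_def case_prod_unfold)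
  qed
  \<comment> \<open>\<open>g\<close> pairs each triple with the exponents of the monomial to which
    it contributes.\<close>
  define g :: "nat \<times> nat \<times> nat \<Rightarrow> (nat \<times> nat) \<times> nat \<times> nat \<times> nat"
    where "g = (\<lambda>(k, p, q). ((2 * p + k, 2 * q + k), (k, p, q)))"
  have bij: "bij_betw g UNIV (Sigma UNIV gauss_fiber)"
    by (rule bij_betwI[where g = snd]) (auto simp: g_def gauss_fiber_def)
  define H where "H = (\<lambda>((m, n), x). \<alpha> m * \<beta> n * gauss_weight a b c x)"
  have "h = (\<lambda>x. H (g x))"
    by (auto simp: h_def H_def g_def gauss_weight_def)
  then have "(H has_sum S) (Sigma UNIV gauss_fiber)"
    using S has_sum_reindex_bij_betw[OF bij, of H S] by simp
  then have 2: "((\<lambda>(m, n). \<alpha> m * \<beta> n * sum (gauss_weight a b c) (gauss_fiber (m, n))) has_sum S) UNIV"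
    by (rule has_sum_SigmaD)
       (auto simp: H_def sum_distrib_left intro!: has_sum_finiteI finite_gauss_fiber)
  show ?thesis using 1 2 by blast
qed

section \<open>Moments and expectations from the moment generating function\<close>

text \<open>Both sides of \<open>mgf\<close> are double power series in \<open>s\<close> and
  \<open>t\<close>, the left one with the moments and the right one with the weights as
  coefficients; coefficients are unique. The factor \<open>Z\<close> allows measures that are not
  yet normalised.\<close>

lemma gauss_moments:
  fixes X Y :: "'a \<Rightarrow> real"
  assumes X: "X \<in> borel_measurable N" and Y: "Y \<in> borel_measurable N"
    and int: "\<And>s t. integrable N (\<lambda>w. exp (s * X w + t * Y w))"
    and mgf: "\<And>s t. (\<integral>w. exp (s * X w + t * Y w) \<partial>N) = Z * exp ((a * s\<^sup>2 + 2 * c * s * t + b * t\<^sup>2) / 2)"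
  shows "(\<integral>w. X w ^ m / fact m * (Y w ^ n / fact n) \<partial>N) = Z * sum (gauss_weight a b c) (gauss_fiber (m, n))"
proof -
  define D where "D = (\<lambda>(m, n). (\<integral>w. X w ^ m / fact m * (Y w ^ n / fact n) \<partial>N) - Z * sum (gauss_weight a b c) (gauss_fiber (m, n)))"
  have "((\<lambda>(m, n). D (m, n) * s ^ m * t ^ n) has_sum 0) UNIV" for s t
  proof -
    \<comment> \<open>One rate for both sequences \<open>s ^ m\<close> and \<open>t ^ m\<close>,
      with leading constant 1.\<close>
    define K where "K = max \<bar>s\<bar> \<bar>t\<bar>"
    have s: "\<bar>s ^ m\<bar> \<le> 1 * K ^ m" and t: "\<bar>t ^ m\<bar> \<le> 1 * K ^ m" and K: "K \<ge> 0" for m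
      by (auto simp: K_def power_abs intro!: power_mono)
    have e: "(\<lambda>m. r ^ m / fact m * x ^ m) sums exp (r * x)" for r x :: real
      using exp_converges[of "r * x"] by (simp add: field_simps power_mult_distrib)
    have 1: "((\<lambda>(m, n). s ^ m * t ^ n * (\<integral>w. X w ^ m / fact m * (Y w ^ n / fact n) \<partial>N))
           has_sum (\<integral>w. exp (s * X w) * exp (t * Y w) \<partial>N)) UNIV"
      by (rule moment_double_series(1)[OF X Y int s t e e])
    obtain S where
      2: "((\<lambda>(m, n). s ^ m * t ^ n * sum (gauss_weight a b c) (gauss_fiber (m, n))) has_sum S) UNIV" and
      3: "((\<lambda>k. c ^ k / fact k * (shifted_series (\<lambda>m. s ^ m) k (a / 2) * shifted_series (\<lambda>m. t ^ m) k (b / 2))) has_sum S) UNIV"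
      using gauss_weight_regroup[of "\<lambda>m. s ^ m" 1 K "\<lambda>m. t ^ m" a b c] s t K by auto
    \<comment> \<open>For geometric coefficients the shifted series is explicit, and the sum over
      \<open>k\<close> becomes the exponential series of \<open>c * s * t\<close>.\<close>
    have ss: "shifted_series (\<lambda>m. r ^ m) k x = r ^ k * exp (r\<^sup>2 * x)" for r k x
    proof -
      have "(\<lambda>u. r ^ k * ((r\<^sup>2) ^ u / fact u * x ^ u)) sums (r ^ k * exp (r\<^sup>2 * x))"
        by (intro sums_mult e)
      moreover have "r ^ k * ((r\<^sup>2) ^ u / fact u * x ^ u) = r ^ (2 * u + k) / fact u * x ^ u" for u
        by (simp add: power_add power_mult)
      ultimately show ?thesis unfolding shifted_series_def
        by (simp only: sums_iff)
    qed
    have "((\<lambda>k. exp (s\<^sup>2 * (a / 2)) * exp (t\<^sup>2 * (b / 2)) * ((c * s * t) ^ k / fact k)) has_sum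
       exp (s\<^sup>2 * (a / 2)) * exp (t\<^sup>2 * (b / 2)) * exp (c * s * t)) UNIV"
      by (intro has_sum_cmult_right exp_has_sum_real)
    also have "(\<lambda>k. exp (s\<^sup>2 * (a / 2)) * exp (t\<^sup>2 * (b / 2)) * ((c * s * t) ^ k / fact k)) =
      (\<lambda>k. c ^ k / fact k * (shifted_series (\<lambda>m. s ^ m) k (a / 2) * shifted_series (\<lambda>m. t ^ m) k (b / 2)))"
      by (simp add: ss power_mult_distrib mult_ac)
    finally have "S = exp (s\<^sup>2 * (a / 2)) * exp (t\<^sup>2 * (b / 2)) * exp (c * s * t)"
      using 3 has_sum_unique by blast
    then have S: "Z * S = (\<integral>w. exp (s * X w) * exp (t * Y w) \<partial>N)"
      using mgf[of s t] by (simp add: exp_add[symmetric] algebra_simps add_divide_distrib)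
    have "(\<lambda>(m, n). D (m, n) * s ^ m * t ^ n) =
      (\<lambda>x. (case x of (m, n) \<Rightarrow> s ^ m * t ^ n * (\<integral>w. X w ^ m / fact m * (Y w ^ n / fact n) \<partial>N)) +
        - Z * (case x of (m, n) \<Rightarrow> s ^ m * t ^ n * sum (gauss_weight a b c) (gauss_fiber (m, n))))"
      unfolding D_def by (rule ext) (simp only: split_beta fst_conv snd_conv, algebra)
    then show ?thesis
      using has_sum_add[OF 1 has_sum_cmult_right[OF 2, of "- Z"]] S by (simp only: mult_minus_left right_minus)
  qed
  then have "D (m, n) = 0" by (rule double_powser_zero_imp_coeff_zero)
  then show ?thesis by (simp add: D_def)
qed

text \<open>The moments are substituted into the moment series of \<open>F\<close> and
  \<open>G\<close>, and the result is regrouped by \<open>k\<close>. Here \<open>a\<close>,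
  \<open>b\<close> act as variances, \<open>c\<close> as the covariance and \<open>Z\<close> as the
  total mass.\<close>

lemma gauss_expectation_has_sum:
  fixes X Y :: "'a \<Rightarrow> real" and \<alpha> \<beta> :: "nat \<Rightarrow> real"
  assumes X: "X \<in> borel_measurable N" and Y: "Y \<in> borel_measurable N"
    and int: "\<And>s t. integrable N (\<lambda>w. exp (s * X w + t * Y w))"
    and mgf: "\<And>s t. (\<integral>w. exp (s * X w + t * Y w) \<partial>N) = Z * exp ((a * s\<^sup>2 + 2 * c * s * t + b * t\<^sup>2) / 2)"
    and \<alpha>: "\<And>m. \<bar>\<alpha> m\<bar> \<le> C * K ^ m" and \<beta>: "\<And>n. \<bar>\<beta> n\<bar> \<le> C * K ^ n" and K: "K \<ge> 0"
    and F: "\<And>x. (\<lambda>m. \<alpha> m / fact m * x ^ m) sums F x"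
    and G: "\<And>x. (\<lambda>n. \<beta> n / fact n * x ^ n) sums G x"
  shows "((\<lambda>k. Z * (c ^ k / fact k * (shifted_series \<alpha> k (a / 2) * shifted_series \<beta> k (b / 2))))
    has_sum (\<integral>w. F (X w) * G (Y w) \<partial>N)) UNIV"
proof -
  obtain S where
    S: "((\<lambda>(m, n). \<alpha> m * \<beta> n * sum (gauss_weight a b c) (gauss_fiber (m, n))) has_sum S) UNIV" and
    S': "((\<lambda>k. c ^ k / fact k * (shifted_series \<alpha> k (a / 2) * shifted_series \<beta> k (b / 2))) has_sum S) UNIV"
    using gauss_weight_regroup[of \<alpha> C K \<beta> a b c, OF \<alpha> \<beta> K] by (elim exE conjE) (rule that)
  define \<mu> where "\<mu> m n = (\<integral>w. X w ^ m / fact m * (Y w ^ n / fact n) \<partial>N)" for m n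
  have \<mu>: "\<mu> m n = Z * sum (gauss_weight a b c) (gauss_fiber (m, n))" for m n
    unfolding \<mu>_def
    by (rule gauss_moments[where X = X and Y = Y and N = N and Z = Z and a = a and b = b and c = c, OF X Y int mgf])
  have "((\<lambda>(m, n). \<alpha> m * \<beta> n * \<mu> m n) has_sum (\<integral>w. F (X w) * G (Y w) \<partial>N)) UNIV"
    unfolding \<mu>_def
    by (rule moment_double_series(1)[where X = X and Y = Y and \<alpha> = \<alpha> and \<beta> = \<beta> and C = C and K = K and F = F and G = G,
          OF X Y int \<alpha> \<beta> F G])
  then have "((\<lambda>(m, n). Z * (\<alpha> m * \<beta> n * sum (gauss_weight a b c) (gauss_fiber (m, n)))) has_sum
      (\<integral>w. F (X w) * G (Y w) \<partial>N)) UNIV"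
    by (simp add: \<mu> mult.left_commute)
  moreover have "((\<lambda>(m, n). Z * (\<alpha> m * \<beta> n * sum (gauss_weight a b c) (gauss_fiber (m, n)))) has_sum Z * S) UNIV"
    using has_sum_cmult_right[OF S, of Z] by (simp add: case_prod_unfold)
  ultimately have "(\<integral>w. F (X w) * G (Y w) \<partial>N) = Z * S" by (rule has_sum_unique)
  then show ?thesis using has_sum_cmult_right[OF S'] by simp
qed

section \<open>Gaussian integrals\<close>

lemma gaussian_nn_integral_real:
  assumes "c > 0"
  shows "(\<integral>\<^sup>+(x::real). ennreal (exp (- c * x\<^sup>2)) \<partial>lborel) = ennreal (sqrt (pi / c))"
proof -
  \<comment> \<open>The standard deviation for which the normal density has exponent
    \<open>- c * x\<^sup>2\<close>.\<close>
  define \<sigma> where "\<sigma> = sqrt (1 / (2 * c))"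
  have \<sigma>: "\<sigma> > 0" "\<sigma>\<^sup>2 = 1 / (2 * c)" using assms by (auto simp: \<sigma>_def)
  have "exp (- c * x\<^sup>2) = sqrt (pi / c) * normal_density 0 \<sigma> x" for x
    using assms by (simp add: normal_density_def \<sigma>(2))
  then have "(\<integral>\<^sup>+x. ennreal (exp (- c * x\<^sup>2)) \<partial>lborel) = (\<integral>\<^sup>+x. ennreal (sqrt (pi / c) * normal_density 0 \<sigma> x) \<partial>lborel)"
    by simp
  also have "\<dots> = ennreal (\<integral>x. sqrt (pi / c) * normal_density 0 \<sigma> x \<partial>lborel)"
    by (rule nn_integral_eq_integral) (use assms \<sigma>(1) in auto)
  finally show ?thesis using \<sigma>(1) by simp
qed

text \<open>The nonnegative integral factors over coordinates without any integrability condition;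
  its finite value then yields integrability.\<close>

lemma gaussian_integral_euclidean:
  fixes c :: real
  assumes "c > 0"
  shows "integrable lborel (\<lambda>x::'a::euclidean_space. exp (- c * (x \<bullet> x)))"
    and "(\<integral>(x::'a). exp (- c * (x \<bullet> x)) \<partial>lborel) = sqrt (pi / c) ^ DIM('a)"
proof -
  have "exp (- c * (x \<bullet> x)) = (\<Prod>b\<in>Basis. exp (- c * (x \<bullet> b)\<^sup>2))" for x :: 'a
    by (simp add: exp_sum[symmetric] euclidean_inner[of x x] sum_distrib_left power2_eq_square sum_negf)
  then have "(\<integral>\<^sup>+(x::'a). ennreal (exp (- c * (x \<bullet> x))) \<partial>lborel) =
      (\<integral>\<^sup>+(x::'a). (\<Prod>b\<in>Basis. ennreal (exp (- c * (x \<bullet> b)\<^sup>2))) \<partial>lborel)"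
    by (simp add: prod_ennreal)
  also have "\<dots> = (\<Prod>b\<in>(Basis::'a set). \<integral>\<^sup>+x. ennreal (exp (- c * x\<^sup>2)) \<partial>lborel)"
    by (rule nn_integral_lborel_prod) auto
  also have "\<dots> = ennreal (sqrt (pi / c) ^ DIM('a))"
    unfolding gaussian_nn_integral_real[OF assms] using assms by (simp add: ennreal_power)
  finally have nn: "(\<integral>\<^sup>+(x::'a). ennreal (exp (- c * (x \<bullet> x))) \<partial>lborel) = ennreal (sqrt (pi / c) ^ DIM('a))" .
  have m: "(\<lambda>x::'a. exp (- c * (x \<bullet> x))) \<in> borel_measurable lborel" by measurable
  show "integrable lborel (\<lambda>x::'a. exp (- c * (x \<bullet> x)))"
    by (rule integrableI_nonneg[OF m]) (use nn in auto)
  show "(\<integral>(x::'a). exp (- c * (x \<bullet> x)) \<partial>lborel) = sqrt (pi / c) ^ DIM('a)"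
    by (subst integral_eq_nn_integral[OF m]) (use nn assms in auto)
qed

lemma lborel_translate:
  fixes f :: "'a::euclidean_space \<Rightarrow> real"
  assumes [measurable]: "f \<in> borel_measurable borel"
  shows "integrable lborel (\<lambda>x. f (x - u)) \<longleftrightarrow> integrable lborel f"
    and "(\<integral>x. f (x - u) \<partial>lborel) = (\<integral>x. f x \<partial>lborel)"
proof -
  have d: "distr lborel borel ((+) (- u)) = (lborel :: 'a measure)"
    by (rule lborel_distr_plus)
  show "integrable lborel (\<lambda>x. f (x - u)) \<longleftrightarrow> integrable lborel f"
    using integrable_distr_eq[of "(+) (- u)" "lborel :: 'a measure" borel f] by (simp add: d)
  show "(\<integral>x. f (x - u) \<partial>lborel) = (\<integral>x. f x \<partial>lborel)"
    using integral_distr[of "(+) (- u)" "lborel :: 'a measure" borel f] by (simp add: d)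
qed

lemma borel_measurable_matrix_vector_mult [measurable]:
  fixes A :: "real^'n^'m"
  shows "(\<lambda>x. A *v x) \<in> borel_measurable borel"
  by (intro borel_measurable_continuous_onI linear_continuous_on matrix_vector_mul_bounded_linear)

section \<open>Gaussian kernels with a positive definite precision matrix\<close>

text \<open>The density without its constant; the constant is identified only in
  \<open>gauss_mass_det\<close>.\<close>

definition gauss_kernel :: "real^'n^'n \<Rightarrow> real^'n \<Rightarrow> real" where
  "gauss_kernel P x = exp (- (x \<bullet> (P *v x)) / 2)"

definition gauss_mass :: "real^'n^'n \<Rightarrow> real" where
  "gauss_mass P = (\<integral>x. gauss_kernel P x \<partial>lborel)"

lemma borel_measurable_gauss_kernel [measurable]: "gauss_kernel P \<in> borel_measurable borel"
  unfolding gauss_kernel_def by measurable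

text \<open>Symmetric positive definiteness with an explicit lower constant, which gives direct
  comparison with a spherical Gaussian.\<close>

definition coercive :: "real^'n^'n \<Rightarrow> bool" where
  "coercive P \<longleftrightarrow> transpose P = P \<and> (\<exists>c>0. \<forall>x. x \<bullet> (P *v x) \<ge> c * (x \<bullet> x))"

lemma coercive_inv:
  fixes P :: "real^'n^'n"
  assumes "coercive P"
  shows "P ** matrix_inv P = mat 1" "matrix_inv P ** P = mat 1" "invertible P"
    "transpose (matrix_inv P) = matrix_inv P"
proof -
  obtain c where c: "c > 0" "\<And>x. x \<bullet> (P *v x) \<ge> c * (x \<bullet> x)" and t: "transpose P = P"
    using assms unfolding coercive_def by blast
  have "x = 0" if "P *v x = 0" for x
    using c(2)[of x] that c(1) inner_ge_zero[of x] by (simp add: mult_le_0_iff)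
  then show inv: "invertible P"
    unfolding invertible_left_inverse matrix_left_invertible_ker by blast
  then show 1: "P ** matrix_inv P = mat 1" "matrix_inv P ** P = mat 1"
    using someI_ex[of "\<lambda>A'. P ** A' = mat 1 \<and> A' ** P = mat 1"] unfolding matrix_inv_def invertible_def by blast+
  have "transpose (matrix_inv P) ** P = mat 1"
    using arg_cong[OF 1(1), of transpose] by (simp add: matrix_transpose_mul t)
  then show "transpose (matrix_inv P) = matrix_inv P"
    by (metis 1(1) matrix_mul_assoc matrix_mul_lid matrix_mul_rid)
qed

lemma integrable_gauss_kernel:
  assumes "coercive P"
  shows "integrable lborel (gauss_kernel P)"
proof -
  obtain c where c: "c > 0" "\<And>x. x \<bullet> (P *v x) \<ge> c * (x \<bullet> x)"
    using assms unfolding coercive_def by blast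
  show ?thesis
    by (rule Bochner_Integration.integrable_bound[OF gaussian_integral_euclidean(1)[of "c / 2"]])
       (use c in \<open>auto simp: gauss_kernel_def\<close>)
qed

text \<open>The centre \<open>matrix_inv P *v t\<close> is mapped to \<open>t\<close> by
  \<open>P\<close>, and symmetry of \<open>P\<close> makes the two cross terms equal.\<close>

lemma gauss_kernel_complete_square:
  fixes P :: "real^'n^'n"
  assumes "coercive P"
  shows "exp (t \<bullet> x) * gauss_kernel P x =
    exp ((t \<bullet> (matrix_inv P *v t)) / 2) * gauss_kernel P (x - matrix_inv P *v t)"
proof -
  let ?u = "matrix_inv P *v t"
  have Pu: "P *v ?u = t" by (simp add: matrix_vector_mul_assoc coercive_inv[OF assms])
  have "transpose P = P" using assms by (simp add: coercive_def)
  then have "?u \<bullet> (P *v x) = t \<bullet> x"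
    by (metis Pu dot_lmul_matrix vector_transpose_matrix)
  moreover have "x \<bullet> (P *v ?u) = t \<bullet> x" "?u \<bullet> (P *v ?u) = t \<bullet> ?u" by (simp_all add: Pu inner_commute)
  ultimately have "(x - ?u) \<bullet> (P *v (x - ?u)) = x \<bullet> (P *v x) - 2 * (t \<bullet> x) + t \<bullet> ?u"
    by (simp add: matrix_vector_mult_diff_distrib inner_diff_left inner_diff_right)
  then show ?thesis
    by (simp add: gauss_kernel_def exp_add[symmetric] field_simps)
qed

text \<open>After completing the square only a translate of the kernel is integrated, and Lebesgue
  measure is translation invariant.\<close>

lemma gauss_kernel_mgf:
  fixes P :: "real^'n^'n"
  assumes "coercive P"
  shows "integrable lborel (\<lambda>x. exp (t \<bullet> x) * gauss_kernel P x)"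
    and "(\<integral>x. exp (t \<bullet> x) * gauss_kernel P x \<partial>lborel) = gauss_mass P * exp ((t \<bullet> (matrix_inv P *v t)) / 2)"
  unfolding gauss_kernel_complete_square[OF assms] gauss_mass_def
  by (simp_all add: lborel_translate integrable_gauss_kernel[OF assms])

text \<open>Leibniz expansion: a permutation other than the identity moves at least two points, so
  after one factor is differentiated another factor still vanishes at 0.\<close>

lemma det_identity_perturbation_derivative:
  fixes N :: "real^'n^'n"
  shows "((\<lambda>h. det (mat 1 + h *\<^sub>R N)) has_real_derivative trace N) (at 0)"
proof -
  let ?\<delta> = "\<lambda>i j::'n. if i = j then 1 else 0 :: real"
  let ?S = "{p. p permutes (UNIV :: 'n set)}"
  have "((\<lambda>h. \<Sum>p\<in>?S. of_int (sign p) * (\<Prod>i\<in>UNIV. ?\<delta> i (p i) + h * N$i$p i)) has_real_derivative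
     (\<Sum>p\<in>?S. of_int (sign p) * (\<Sum>i\<in>UNIV. N$i$p i * (\<Prod>j\<in>UNIV-{i}. ?\<delta> j (p j) + 0 * N$j$p j)))) (at 0)"
    by (intro DERIV_sum DERIV_cmult has_field_derivative_prod) (auto intro!: derivative_eq_intros)
  also have "(\<Sum>p\<in>?S. of_int (sign p) * (\<Sum>i\<in>UNIV. N$i$p i * (\<Prod>j\<in>UNIV-{i}. ?\<delta> j (p j) + 0 * N$j$p j)))
     = (\<Sum>p\<in>?S. if p = id then trace N else 0)"
  proof (rule sum.cong[OF refl])
    fix p assume p: "p \<in> ?S"
    show "of_int (sign p) * (\<Sum>i\<in>UNIV. N$i$p i * (\<Prod>j\<in>UNIV-{i}. ?\<delta> j (p j) + 0 * N$j$p j))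
      = (if p = id then trace N else 0)"
    proof (cases "p = id")
      case False
      then obtain j where j: "p j \<noteq> j" by (auto simp: fun_eq_iff)
      have "(\<Prod>k\<in>UNIV-{i}. ?\<delta> k (p k) + 0 * N$k$p k) = 0" for i
      proof -
        \<comment> \<open>If \<open>i\<close> is the moved point \<open>j\<close> itself, then
          \<open>p j\<close> is another moved point by injectivity.\<close>
        obtain k where "k \<noteq> i" "p k \<noteq> k"
          using j p by (metis mem_Collect_eq permutes_inj inj_eq)
        then show ?thesis by (intro prod_zero bexI[of _ k]) auto
      qed
      then show ?thesis using False by (simp only: mult_zero_right sum.neutral_const if_False)
    qed (simp add: trace_def)
  qed
  also have "\<dots> = trace N" by (simp add: permutes_id)
  finally show ?thesis
    unfolding det_def by (simp add: mat_def)
qed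

definition gauss_kernel_measure :: "real^'n^'n \<Rightarrow> (real^'n) measure" where
  "gauss_kernel_measure P = density lborel (\<lambda>x. ennreal (gauss_kernel P x))"

lemma gauss_kernel_pos: "gauss_kernel P x > 0"
  by (simp add: gauss_kernel_def)

lemma gauss_kernel_measure_integral:
  assumes [measurable]: "f \<in> borel_measurable borel"
  shows "integrable (gauss_kernel_measure P) f \<longleftrightarrow> integrable lborel (\<lambda>x. f x * gauss_kernel P x)"
    and "integral\<^sup>L (gauss_kernel_measure P) f = (\<integral>x. f x * gauss_kernel P x \<partial>lborel)"
proof -
  have "AE x in lborel. 0 \<le> gauss_kernel P x"
    by (simp add: less_imp_le[OF gauss_kernel_pos])
  then show "integrable (gauss_kernel_measure P) f \<longleftrightarrow> integrable lborel (\<lambda>x. f x * gauss_kernel P x)"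
    and "integral\<^sup>L (gauss_kernel_measure P) f = (\<integral>x. f x * gauss_kernel P x \<partial>lborel)"
    unfolding gauss_kernel_measure_def
    by (simp_all add: integrable_density integral_density mult.commute)
qed

section \<open>Moments of coordinates and dependence of the mass on the precision matrix\<close>

text \<open>The vector generating function at \<open>axis i s + axis j t\<close>. The case
  \<open>i = j\<close> is included, so diagonal entries need no separate treatment.\<close>

lemma gauss_pair_mgf:
  fixes P :: "real^'n^'n"
  assumes P: "coercive P"
  defines "\<Gamma> \<equiv> matrix_inv P"
  shows "integrable (gauss_kernel_measure P) (\<lambda>x. exp (s * x$i + t * x$j))"
    and "(\<integral>x. exp (s * x$i + t * x$j) \<partial>gauss_kernel_measure P) =
      gauss_mass P * exp ((\<Gamma>$i$i * s\<^sup>2 + 2 * \<Gamma>$i$j * s * t + \<Gamma>$j$j * t\<^sup>2) / 2)"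
proof -
  define v where "v = axis i s + axis j t"
  have v: "v \<bullet> x = s * x$i + t * x$j" for x
    by (simp add: v_def inner_add_left inner_axis' )
  have *: "\<Gamma>$j$i = \<Gamma>$i$j"
    using arg_cong[OF coercive_inv(4)[OF P], of "\<lambda>A. A$i$j"] by (simp add: \<Gamma>_def transpose_def)
  have ax: "(\<Gamma> *v axis k r)$l = \<Gamma>$l$k * r" for k l r
    by (simp add: matrix_vector_mult_def axis_def if_distrib cong: if_cong)
  have "v \<bullet> (\<Gamma> *v v) = \<Gamma>$i$i * s\<^sup>2 + 2 * \<Gamma>$i$j * s * t + \<Gamma>$j$j * t\<^sup>2"
    unfolding v by (simp add: v_def matrix_vector_right_distrib ax * power2_eq_square algebra_simps)
  then show "integrable (gauss_kernel_measure P) (\<lambda>x. exp (s * x$i + t * x$j))"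
    and "(\<integral>x. exp (s * x$i + t * x$j) \<partial>gauss_kernel_measure P) =
      gauss_mass P * exp ((\<Gamma>$i$i * s\<^sup>2 + 2 * \<Gamma>$i$j * s * t + \<Gamma>$j$j * t\<^sup>2) / 2)"
    using gauss_kernel_mgf[OF P, of v]
    by (simp_all add: gauss_kernel_measure_integral v \<Gamma>_def)
qed

lemma gauss_second_moment:
  fixes P :: "real^'n^'n"
  assumes P: "coercive P"
  shows "integrable lborel (\<lambda>x. x$i * x$j * gauss_kernel P x)"
    and "(\<integral>x. x$i * x$j * gauss_kernel P x \<partial>lborel) = gauss_mass P * matrix_inv P $ i $ j"
proof -
  let ?N = "gauss_kernel_measure P"
  have m: "(\<lambda>x. x$k) \<in> borel_measurable ?N" for k :: 'n
    unfolding gauss_kernel_measure_def by simp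
  have b: "\<bar>of_bool (m = 1)\<bar> \<le> 1 * (1::real) ^ m" for m :: nat by simp
  have s: "(\<lambda>m. of_bool (m = 1) / fact m * x ^ m) sums x" for x :: real
  proof -
    have "(\<lambda>m. of_bool (m = 1) / fact m * x ^ m) = (\<lambda>m. if m = 1 then x ^ m / fact m else 0)"
      by (rule ext) simp
    then show ?thesis using sums_single[of 1 "\<lambda>m. x ^ m / fact m"] by simp
  qed
  show "integrable lborel (\<lambda>x. x$i * x$j * gauss_kernel P x)"
    using moment_double_series(2)[OF m m gauss_pair_mgf(1)[OF P] b b s s]
    by (simp add: gauss_kernel_measure_integral)
  \<comment> \<open>A single triple lies over \<open>(1, 1)\<close>, and its weight is the
    covariance entry itself.\<close>
  have "gauss_fiber (1, 1) = {(1, 0, 0)}" unfolding gauss_fiber_def by (auto, presburger+)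
  then show "(\<integral>x. x$i * x$j * gauss_kernel P x \<partial>lborel) = gauss_mass P * matrix_inv P $ i $ j"
    using gauss_moments[OF m[of i] m[of j] gauss_pair_mgf[OF P], of 1 1]
    by (simp add: gauss_kernel_measure_integral gauss_weight_def)
qed

text \<open>The double sum is the trace of \<open>B ** matrix_inv P\<close>, because the inverse is
  symmetric.\<close>

lemma gauss_quadratic_moment:
  fixes P B :: "real^'n^'n"
  assumes P: "coercive P"
  shows "integrable lborel (\<lambda>x. (x \<bullet> (B *v x)) * gauss_kernel P x)"
    and "(\<integral>x. (x \<bullet> (B *v x)) * gauss_kernel P x \<partial>lborel) = gauss_mass P * (\<Sum>i\<in>UNIV. \<Sum>j\<in>UNIV. B$i$j * matrix_inv P $ i $ j)"
proof -
  have eq: "(x \<bullet> (B *v x)) * gauss_kernel P x = (\<Sum>i\<in>UNIV. \<Sum>j\<in>UNIV. B$i$j * (x$i * x$j * gauss_kernel P x))" for x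
    by (simp add: inner_vec_def matrix_vector_mult_def sum_distrib_left sum_distrib_right mult_ac)
  show "integrable lborel (\<lambda>x. (x \<bullet> (B *v x)) * gauss_kernel P x)"
    unfolding eq by (intro Bochner_Integration.integrable_sum integrable_mult_right gauss_second_moment P)
  show "(\<integral>x. (x \<bullet> (B *v x)) * gauss_kernel P x \<partial>lborel) = gauss_mass P * (\<Sum>i\<in>UNIV. \<Sum>j\<in>UNIV. B$i$j * matrix_inv P $ i $ j)"
    unfolding eq
    by (subst Bochner_Integration.integral_sum, intro Bochner_Integration.integrable_sum integrable_mult_right gauss_second_moment P,
        subst Bochner_Integration.integral_sum, intro integrable_mult_right gauss_second_moment P)
       (simp add: gauss_second_moment[OF P] sum_distrib_left mult.left_commute )
qed

text \<open>Integrating \<open>exp y \<ge> 1 + y\<close> against the kernel of \<open>P\<close>,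
  with \<open>y\<close> minus half the quadratic form of \<open>Q - P\<close>. This is the tangent
  bound of a convex function of the precision matrix.\<close>

lemma gauss_mass_convexity:
  fixes P Q :: "real^'n^'n"
  assumes P: "coercive P" and Q: "coercive Q"
  shows "gauss_mass Q \<ge> gauss_mass P * (1 - (\<Sum>i\<in>UNIV. \<Sum>j\<in>UNIV. (Q - P)$i$j * matrix_inv P $ i $ j) / 2)"
proof -
  let ?f = "\<lambda>x. gauss_kernel P x - (x \<bullet> ((Q - P) *v x)) * gauss_kernel P x / 2"
  have "?f x \<le> gauss_kernel Q x" for x
  proof -
    let ?q = "x \<bullet> ((Q - P) *v x)"
    have "gauss_kernel Q x = gauss_kernel P x * exp (- ?q / 2)"
      by (simp add: gauss_kernel_def exp_add[symmetric] matrix_vector_mult_diff_rdistrib inner_diff_right field_simps)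
    moreover have "gauss_kernel P x * exp (- ?q / 2) \<ge> gauss_kernel P x * (1 + - ?q / 2)"
      using gauss_kernel_pos[of P x] exp_ge_add_one_self[of "- ?q / 2"] by (intro mult_left_mono) auto
    ultimately show ?thesis by (simp add: algebra_simps add_divide_distrib diff_divide_distrib)
  qed
  then have "(\<integral>x. ?f x \<partial>lborel) \<le> gauss_mass Q"
    unfolding gauss_mass_def
    by (intro integral_mono Bochner_Integration.integrable_diff integrable_divide integrable_gauss_kernel gauss_quadratic_moment P Q)
  moreover have "(\<integral>x. ?f x \<partial>lborel) = gauss_mass P - (gauss_mass P * (\<Sum>i\<in>UNIV. \<Sum>j\<in>UNIV. (Q - P)$i$j * matrix_inv P $ i $ j)) / 2"
    by (simp add: gauss_quadratic_moment[OF P] integrable_gauss_kernel[OF P] gauss_mass_def[symmetric]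
      del: vector_minus_component)
  ultimately show ?thesis by (simp add: algebra_simps)
qed

section \<open>The normalising constant\<close>

lemma matrix_scaleR_vector_mult: "(c *\<^sub>R A) *v x = c *\<^sub>R (A *v x)" for A :: "real^'n^'m"
  by (simp add: matrix_vector_mult_def vec_eq_iff sum_distrib_left mult.assoc)

lemma matrix_mult_scaleR_right: "A ** (c *\<^sub>R C) = c *\<^sub>R (A ** C)" for A :: "real^'n^'m" and C :: "real^'k^'n"
  by (simp add: matrix_matrix_mult_def vec_eq_iff sum_distrib_left mult.left_commute)

text \<open>Since \<open>\<delta> < 1 / 2\<close>, the path \<open>1 + s B\<close> stays positive definite for \<open>\<bar>s\<bar> < 3 / 2\<close>, an open interval
  containing both \<open>0\<close> and \<open>1\<close>.\<close>
locale symmetric_contraction =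
  fixes B :: "real^'n^'n" and \<delta> :: real
  assumes sym: "transpose B = B"
    and contr: "\<And>x. norm (B *v x) \<le> \<delta> * norm x"
    and \<delta>: "0 \<le> \<delta>" "\<delta> < 1 / 2"
begin

definition P :: "real \<Rightarrow> real^'n^'n" where "P s = mat 1 + s *\<^sub>R B"

definition \<Gamma> :: "real \<Rightarrow> real^'n^'n" where "\<Gamma> s = matrix_inv (P s)"

lemma P_mult: "P s *v x = x + s *\<^sub>R (B *v x)"
  by (simp add: P_def matrix_vector_mult_add_rdistrib matrix_scaleR_vector_mult)

lemma quadratic_bound: "\<bar>x \<bullet> (B *v x)\<bar> \<le> \<delta> * (x \<bullet> x)"
proof -
  have "\<bar>x \<bullet> (B *v x)\<bar> \<le> norm x * norm (B *v x)" by (rule Cauchy_Schwarz_ineq2)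
  also have "\<dots> \<le> norm x * (\<delta> * norm x)" by (intro mult_left_mono contr) auto
  finally show ?thesis by (simp add: power2_norm_eq_inner[symmetric] power2_eq_square mult_ac)
qed

text \<open>The perturbation takes at most 3/4 of \<open>x \<bullet> x\<close>, which leaves the
  constant 1/4.\<close>

lemma coercive_P:
  assumes s: "\<bar>s\<bar> < 3 / 2"
  shows "coercive (P s)"
  unfolding coercive_def
proof (intro conjI exI allI)
  show "transpose (P s) = P s"
    using sym by (simp add: P_def transpose_def vec_eq_iff mat_def)
  show "0 < (1 / 4 :: real)" by simp
  fix x
  have "\<bar>s * (x \<bullet> (B *v x))\<bar> \<le> 3 / 2 * (\<delta> * (x \<bullet> x))"
    unfolding abs_mult by (intro mult_mono quadratic_bound) (use s \<delta> in auto)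
  also have "\<dots> \<le> 3 / 2 * (1 / 2 * (x \<bullet> x))"
    by (intro mult_left_mono mult_right_mono) (use \<delta> in auto)
  finally show "1 / 4 * (x \<bullet> x) \<le> x \<bullet> (P s *v x)"
    by (simp add: P_mult inner_add_right)
qed

text \<open>The image \<open>y\<close> of \<open>x\<close> solves
  \<open>y = x - s *\<^sub>R (B *v y)\<close>; the last term has norm at most 3/4 of that of
  \<open>y\<close> and is absorbed, giving the factor 4.\<close>

lemma norm_\<Gamma>:
  assumes s: "\<bar>s\<bar> < 3 / 2"
  shows "norm (\<Gamma> s *v x) \<le> 4 * norm x"
proof -
  let ?y = "\<Gamma> s *v x"
  have "P s *v ?y = x"
    by (simp add: \<Gamma>_def matrix_vector_mul_assoc coercive_inv[OF coercive_P[OF s]])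
  then have "?y = x - s *\<^sub>R (B *v ?y)" by (simp add: P_mult algebra_simps)
  then have "norm ?y \<le> norm x + \<bar>s\<bar> * norm (B *v ?y)"
    by (metis norm_scaleR norm_triangle_ineq4)
  also have "\<bar>s\<bar> * norm (B *v ?y) \<le> 3 / 2 * (1 / 2 * norm ?y)"
  proof (intro mult_mono)
    show "norm (B *v ?y) \<le> 1 / 2 * norm ?y"
      using contr[of ?y] \<delta> mult_right_mono[of \<delta> "1 / 2" "norm ?y"] by simp
  qed (use s in auto)
  finally show ?thesis by simp
qed

text \<open>With \<open>y = \<Gamma> s *v x\<close>, the vectors \<open>P s *v y = x\<close> and
  \<open>P r *v y\<close> differ by a multiple of \<open>B *v y\<close>; applying
  \<open>\<Gamma> r\<close> gives the resolvent identity.\<close>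

lemma \<Gamma>_resolvent:
  assumes s: "\<bar>s\<bar> < 3 / 2" and r: "\<bar>r\<bar> < 3 / 2"
  shows "\<Gamma> r *v x - \<Gamma> s *v x = - (r - s) *\<^sub>R (\<Gamma> r *v (B *v (\<Gamma> s *v x)))"
proof -
  let ?y = "\<Gamma> s *v x"
  have y: "P s *v ?y = x"
    by (simp add: \<Gamma>_def matrix_vector_mul_assoc coercive_inv[OF coercive_P[OF s]])
  have "\<Gamma> r *v (P r *v v) = v" for v
    by (simp add: \<Gamma>_def matrix_vector_mul_assoc coercive_inv[OF coercive_P[OF r]])
  then have z: "\<Gamma> r *v (P r *v ?y) = ?y" .
  have "x - P r *v ?y = - (r - s) *\<^sub>R (B *v ?y)"
    using y by (simp add: P_mult algebra_simps)
  then have "\<Gamma> r *v x - \<Gamma> r *v (P r *v ?y) = \<Gamma> r *v (- (r - s) *\<^sub>R (B *v ?y))"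
    by (metis matrix_vector_mult_diff_distrib)
  then show ?thesis unfolding z by (metis matrix_vector_mult_scaleR)
qed

lemma \<Gamma>_entry_lipschitz:
  assumes s: "\<bar>s\<bar> < 3 / 2" and r: "\<bar>r\<bar> < 3 / 2"
  shows "\<bar>\<Gamma> r $ i $ j - \<Gamma> s $ i $ j\<bar> \<le> 8 * \<bar>r - s\<bar>"
proof -
  let ?e = "axis j 1 :: real^'n"
  have "\<bar>\<Gamma> r $ i $ j - \<Gamma> s $ i $ j\<bar> = \<bar>(\<Gamma> r *v ?e - \<Gamma> s *v ?e) $ i\<bar>"
    by (simp add: matrix_vector_mult_basis column_def)
  also have "\<dots> \<le> norm (\<Gamma> r *v ?e - \<Gamma> s *v ?e)" by (rule component_le_norm_cart)
  also have "\<dots> = \<bar>r - s\<bar> * norm (\<Gamma> r *v (B *v (\<Gamma> s *v ?e)))"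
    unfolding \<Gamma>_resolvent[OF s r] by (simp add: abs_minus_commute)
  also have "norm (\<Gamma> r *v (B *v (\<Gamma> s *v ?e))) \<le> 4 * (1 / 2 * (4 * norm ?e))"
  proof -
    have "norm (B *v (\<Gamma> s *v ?e)) \<le> 1 / 2 * (4 * norm ?e)"
      by (rule order_trans[OF contr]) (intro mult_mono norm_\<Gamma> s, use \<delta> in auto)
    then show ?thesis by (rule order_trans[OF norm_\<Gamma>[OF r] mult_left_mono]) simp
  qed
  finally have "\<bar>\<Gamma> r $ i $ j - \<Gamma> s $ i $ j\<bar> \<le> \<bar>r - s\<bar> * (4 * (1 / 2 * (4 * norm ?e)))"
    by (simp add: mult_left_mono)
  then show ?thesis by (simp add: norm_axis_1)
qed

text \<open>The trace of \<open>\<Gamma> s ** B\<close>: the logarithmic derivative of the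
  determinant along the path, and -2 times that of the mass.\<close>

definition M :: "real \<Rightarrow> real" where "M s = (\<Sum>i\<in>UNIV. \<Sum>j\<in>UNIV. B$i$j * \<Gamma> s $ i $ j)"

lemma isCont_M:
  assumes s: "\<bar>s\<bar> < 3 / 2"
  shows "isCont M s"
proof -
  have "((\<lambda>r. \<Gamma> r $ i $ j) \<longlongrightarrow> \<Gamma> s $ i $ j) (at s)" for i j
  proof -
    have "\<forall>\<^sub>F r in at s. r \<in> {-(3/2)<..<3/2}"
      using s by (intro eventually_at_in_open') auto
    then have ev: "\<forall>\<^sub>F r in at s. norm (\<Gamma> r $ i $ j - \<Gamma> s $ i $ j) \<le> 8 * \<bar>r - s\<bar>"
      by eventually_elim (use \<Gamma>_entry_lipschitz[OF s] in auto)
    have "((\<lambda>r. 8 * \<bar>r - s\<bar>) \<longlongrightarrow> 0) (at s)"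
      by (rule tendsto_eq_intros refl)+ simp
    from Lim_null_comparison[OF ev this] show ?thesis by (simp add: LIM_zero_iff)
  qed
  then show ?thesis unfolding isCont_def M_def by (intro tendsto_sum tendsto_mult tendsto_const)
qed

definition mass :: "real \<Rightarrow> real" where "mass s = gauss_mass (P s)"

lemma mass_nonneg: "mass s \<ge> 0"
  by (simp add: mass_def gauss_mass_def gauss_kernel_def)

lemma mass_convexity:
  assumes s: "\<bar>s\<bar> < 3 / 2" and r: "\<bar>r\<bar> < 3 / 2"
  shows "mass r \<ge> mass s * (1 - (r - s) / 2 * M s)"
proof -
  have "P r - P s = (r - s) *\<^sub>R B" by (simp add: P_def algebra_simps)
  then have "(\<Sum>i\<in>UNIV. \<Sum>j\<in>UNIV. (P r - P s)$i$j * matrix_inv (P s) $ i $ j) = (r - s) * M s"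
    by (simp add: M_def \<Gamma>_def sum_distrib_left mult.assoc)
  then show ?thesis
    using gauss_mass_convexity[OF coercive_P[OF s] coercive_P[OF r]] by (simp add: mass_def)
qed

text \<open>Convexity, used once at \<open>s\<close> and once at \<open>r\<close>, traps the difference quotient between two
  quantities with the same limit, so no differentiation under the integral is needed.\<close>
lemma mass_deriv:
  assumes s: "\<bar>s\<bar> < 3 / 2"
  shows "(mass has_real_derivative - (M s * mass s) / 2) (at s)"
proof -
  have near: "\<forall>\<^sub>F r in at s. \<bar>r\<bar> < 3 / 2"
  proof -
    have "\<forall>\<^sub>F r in at s. r \<in> {-(3/2)<..<3/2}"
      using s by (intro eventually_at_in_open') auto
    then show ?thesis by eventually_elim auto
  qed
  have M: "(M \<longlongrightarrow> M s) (at s)" using isCont_M[OF s] by (simp add: isCont_def)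
  have u: "((\<lambda>r. 1 + (r - s) / 2 * M r) \<longlongrightarrow> 1) (at s)"
    by (auto intro!: tendsto_eq_intros M)
  then have pos: "\<forall>\<^sub>F r in at s. 1 + (r - s) / 2 * M r > 0"
    by (rule order_tendstoD) simp
  \<comment> \<open>Continuity comes first because the error term of the difference quotient
    contains \<open>mass r\<close>. The upper bound is the convexity inequality based at
    \<open>r\<close>, solved for \<open>mass r\<close>.\<close>
  have cont: "(mass \<longlongrightarrow> mass s) (at s)"
  proof (rule tendsto_sandwich)
    show "\<forall>\<^sub>F r in at s. mass s * (1 - (r - s) / 2 * M s) \<le> mass r"
      using near by eventually_elim (rule mass_convexity[OF s])
    show "\<forall>\<^sub>F r in at s. mass r \<le> mass s / (1 + (r - s) / 2 * M r)"
      using near pos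
    proof eventually_elim
      case (elim r)
      have "mass r * (1 + (r - s) / 2 * M r) \<le> mass s"
        using mass_convexity[OF elim(1) s] by (simp add: algebra_simps diff_divide_distrib)
      then show ?case using elim by (simp add: pos_le_divide_eq)
    qed
    show "((\<lambda>r. mass s * (1 - (r - s) / 2 * M s)) \<longlongrightarrow> mass s) (at s)"
      by (auto intro!: tendsto_eq_intros)
    show "((\<lambda>r. mass s / (1 + (r - s) / 2 * M r)) \<longlongrightarrow> mass s) (at s)"
      using tendsto_divide[OF tendsto_const[of "mass s"] u] by simp
  qed
  have lim: "((\<lambda>r. \<bar>M r * mass r - M s * mass s\<bar> / 2) \<longlongrightarrow> 0) (at s)"
    by (auto intro!: tendsto_eq_intros M cont)
  have "\<forall>\<^sub>F r in at s. norm ((mass r - mass s) / (r - s) - - (M s * mass s) / 2) \<le> \<bar>M r * mass r - M s * mass s\<bar> / 2"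
    using near eventually_neq_at_within[of s s UNIV]
  proof eventually_elim
    case (elim r)
    let ?h = "r - s"
    have 1: "mass r - mass s + ?h * (M s * mass s) / 2 \<ge> 0"
      using mass_convexity[OF s elim(1)] by (simp add: algebra_simps diff_divide_distrib)
    have 2: "mass r - mass s + ?h * (M r * mass r) / 2 \<le> 0"
      using mass_convexity[OF elim(1) s] by (simp add: algebra_simps diff_divide_distrib)
    have "mass r - mass s + ?h * (M s * mass s) / 2 \<le> - (?h * (M r * mass r - M s * mass s) / 2)"
      using 2 by (simp add: algebra_simps diff_divide_distrib add_divide_distrib)
    then have "\<bar>mass r - mass s + ?h * (M s * mass s) / 2\<bar> \<le> \<bar>?h\<bar> * (\<bar>M r * mass r - M s * mass s\<bar> / 2)"
      using 1 abs_ge_minus_self[of "?h * (M r * mass r - M s * mass s) / 2"] by (simp add: abs_mult)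
    moreover have "(mass r - mass s) / ?h - - (M s * mass s) / 2 = (mass r - mass s + ?h * (M s * mass s) / 2) / ?h"
      using elim by (simp add: field_simps)
    ultimately show ?case
      using elim by (simp add: abs_divide divide_le_eq mult.commute)
  qed
  from Lim_null_comparison[OF this lim] show ?thesis
    unfolding has_field_derivative_iff by (rule LIM_zero_cancel)
qed

text \<open>Factoring \<open>P s\<close> out of \<open>P r\<close> and using multiplicativity of the
  determinant reduces the claim to a perturbation of the identity.\<close>

lemma det_deriv:
  assumes s: "\<bar>s\<bar> < 3 / 2"
  shows "((\<lambda>s. det (P s)) has_real_derivative det (P s) * M s) (at s)"
proof -
  have "P r = P s ** (mat 1 + (r - s) *\<^sub>R (\<Gamma> s ** B))" for r
  proof -
    have "P s ** (mat 1 + (r - s) *\<^sub>R (\<Gamma> s ** B)) = P s + (r - s) *\<^sub>R ((P s ** \<Gamma> s) ** B)"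
      by (simp add: matrix_add_ldistrib matrix_mul_assoc matrix_mult_scaleR_right)
    also have "\<dots> = P r"
      by (simp add: \<Gamma>_def coercive_inv[OF coercive_P[OF s]]) (simp add: P_def algebra_simps)
    finally show ?thesis by simp
  qed
  then have eq: "(\<lambda>r. det (P r)) = (\<lambda>r. det (P s) * det (mat 1 + (r - s) *\<^sub>R (\<Gamma> s ** B)))"
    by (metis det_mul)
  have M: "M s = trace (\<Gamma> s ** B)"
  proof -
    have "B $ i $ j = B $ j $ i" for i j
      using arg_cong[OF sym, of "\<lambda>A. A $ j $ i"] by (simp add: transpose_def)
    then show ?thesis
      by (simp add: M_def trace_def matrix_matrix_mult_def mult.commute)
  qed
  have "((\<lambda>r. det (mat 1 + (r - s) *\<^sub>R (\<Gamma> s ** B))) has_real_derivative trace (\<Gamma> s ** B) * 1) (at s)"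
    by (rule DERIV_chain2[where f = "\<lambda>h. det (mat 1 + h *\<^sub>R (\<Gamma> s ** B))"])
       (use det_identity_perturbation_derivative in \<open>auto intro!: derivative_eq_intros\<close>)
  then show ?thesis unfolding eq M by (intro DERIV_cmult) simp
qed

text \<open>The squared mass makes the two logarithmic derivatives cancel, and this form requires no
  prior knowledge of the sign of the determinant. The value is read off at
  \<open>s = 0\<close>.\<close>

lemma gauss_mass_det: "(gauss_mass (mat 1 + B))\<^sup>2 * det (mat 1 + B) = (2 * pi) ^ CARD('n)"
proof -
  let ?Q = "\<lambda>s. (mass s)\<^sup>2 * det (P s)"
  have "?Q 1 = ?Q 0"
  proof (rule DERIV_isconst3[of "-(3/2)" "3/2" 1 0 ?Q])
    fix s :: real assume "s \<in> {-(3/2)<..<3/2}"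
    then have s: "\<bar>s\<bar> < 3 / 2" by auto
    have "(?Q has_real_derivative (mass s)\<^sup>2 * (det (P s) * M s) + (2 * mass s * (- (M s * mass s) / 2)) * det (P s)) (at s)"
      using mass_deriv[OF s] det_deriv[OF s] by (auto intro!: derivative_eq_intros simp: power2_eq_square)
    then show "(?Q has_real_derivative 0) (at s)"
      by (simp add: power2_eq_square algebra_simps)
  qed auto
  moreover have "mass 0 = sqrt (2 * pi) ^ CARD('n)"
    using gaussian_integral_euclidean(2)[of "1 / 2", where 'a = "real^'n"]
    by (simp add: mass_def gauss_mass_def gauss_kernel_def P_def mult.commute)
  ultimately show ?thesis
    by (simp add: P_def mass_def power_mult[symmetric] mult.commute[of _ 2]) (simp add: power_mult)
qed

end

section \<open>Perturbation estimates\<close>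

lemma sums_abs_le:
  fixes f g :: "nat \<Rightarrow> real"
  assumes "f sums s" "g sums t" "\<And>n. \<bar>f n\<bar> \<le> g n"
  shows "\<bar>s\<bar> \<le> t"
proof (rule abs_leI)
  show "s \<le> t" by (rule sums_le[OF _ assms(1,2)]) (use assms(3) abs_le_D1 in blast)
  show "- s \<le> t" by (rule sums_le[OF _ sums_minus[OF assms(1)] assms(2)]) (use assms(3) abs_le_D2 in blast)
qed

locale exp_type_pair =
  fixes \<alpha> \<beta> :: "nat \<Rightarrow> real" and C K :: real
  assumes \<alpha>: "\<And>m. \<bar>\<alpha> m\<bar> \<le> C * K ^ m" and \<beta>: "\<And>m. \<bar>\<beta> m\<bar> \<le> C * K ^ m" and K: "K \<ge> 1"
begin

text \<open>The 2 in the exponent leaves room for the factor \<open>2 ^ u\<close> in the Lipschitz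
  estimate, so one constant serves both for size and for variation.\<close>

definition G :: real where "G = C * exp (2 * K\<^sup>2)"

lemma C_nonneg: "C \<ge> 0" using \<alpha>[of 0] by simp

lemma G_nonneg: "G \<ge> 0" using C_nonneg by (simp add: G_def)

lemma shifted_series_bound:
  assumes g: "\<And>m. \<bar>\<gamma> m\<bar> \<le> C * K ^ m" and x: "\<bar>x\<bar> \<le> 1"
  shows "\<bar>shifted_series \<gamma> k x\<bar> \<le> G * K ^ k"
proof -
  have "\<bar>shifted_series \<gamma> k x\<bar> \<le> C * K ^ k * exp (K\<^sup>2 * \<bar>x\<bar>)"
    by (rule shifted_series_has_sum(2)[OF g])
  also have "\<dots> \<le> C * K ^ k * exp (2 * K\<^sup>2)"
    using x C_nonneg K mult_left_mono[OF x, of "K\<^sup>2"] by (intro mult_left_mono) auto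
  finally show ?thesis by (simp add: G_def mult_ac)
qed

text \<open>Termwise, \<open>\<bar>x ^ u - y ^ u\<bar>\<close> is at most
  \<open>u * \<bar>x - y\<bar>\<close>, and \<open>u \<le> 2 ^ u\<close> keeps the majorant an
  exponential series.\<close>

lemma shifted_series_lipschitz:
  assumes g: "\<And>m. \<bar>\<gamma> m\<bar> \<le> C * K ^ m" and x: "\<bar>x\<bar> \<le> 1" and y: "\<bar>y\<bar> \<le> 1"
  shows "\<bar>shifted_series \<gamma> k x - shifted_series \<gamma> k y\<bar> \<le> G * K ^ k * \<bar>x - y\<bar>"
proof (rule sums_abs_le)
  show "(\<lambda>u. \<gamma> (2 * u + k) / fact u * x ^ u - \<gamma> (2 * u + k) / fact u * y ^ u) sums
    (shifted_series \<gamma> k x - shifted_series \<gamma> k y)"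
    by (intro sums_diff has_sum_imp_sums shifted_series_has_sum(1)[OF g])
  have "(\<lambda>u. C * K ^ k * \<bar>x - y\<bar> * ((2 * K\<^sup>2) ^ u / fact u)) sums (C * K ^ k * \<bar>x - y\<bar> * exp (2 * K\<^sup>2))"
    by (intro sums_mult has_sum_imp_sums exp_has_sum_real)
  then show "(\<lambda>u. C * K ^ k * \<bar>x - y\<bar> * ((2 * K\<^sup>2) ^ u / fact u)) sums (G * K ^ k * \<bar>x - y\<bar>)"
    by (simp add: G_def mult_ac)
  fix u
  have "\<bar>x ^ u - y ^ u\<bar> \<le> real u * \<bar>x - y\<bar>"
    using norm_power_diff[of x y u] x y by simp
  also have "\<dots> \<le> 2 ^ u * \<bar>x - y\<bar>"
    by (intro mult_right_mono) (auto simp: less_imp_le[OF of_nat_less_two_power])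
  finally have d: "\<bar>x ^ u - y ^ u\<bar> \<le> 2 ^ u * \<bar>x - y\<bar>" .
  have "\<bar>\<gamma> (2 * u + k) / fact u * x ^ u - \<gamma> (2 * u + k) / fact u * y ^ u\<bar> =
    \<bar>\<gamma> (2 * u + k) / fact u * 1 ^ u\<bar> * \<bar>x ^ u - y ^ u\<bar>"
    by (simp add: abs_mult[symmetric] right_diff_distrib del: abs_divide)
  also have "\<dots> \<le> (C * K ^ k * ((K\<^sup>2 * \<bar>1\<bar>) ^ u / fact u)) * (2 ^ u * \<bar>x - y\<bar>)"
    by (rule mult_mono[OF exp_type_term_bound[OF g] d]) (use C_nonneg K in auto)
  also have "\<dots> = C * K ^ k * \<bar>x - y\<bar> * ((2 * K\<^sup>2) ^ u / fact u)"
    by (simp add: power_mult_distrib mult_ac)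
  finally show "\<bar>\<gamma> (2 * u + k) / fact u * x ^ u - \<gamma> (2 * u + k) / fact u * y ^ u\<bar> \<le>
    C * K ^ k * \<bar>x - y\<bar> * ((2 * K\<^sup>2) ^ u / fact u)" .
qed

definition T :: "nat \<Rightarrow> real \<Rightarrow> real \<Rightarrow> real" where
  "T k a b = shifted_series \<alpha> k (a / 2) * shifted_series \<beta> k (b / 2)"

lemma T_bound:
  assumes "\<bar>a\<bar> \<le> 2" "\<bar>b\<bar> \<le> 2"
  shows "\<bar>T k a b\<bar> \<le> G\<^sup>2 * (K\<^sup>2) ^ k"
proof -
  have "\<bar>T k a b\<bar> \<le> (G * K ^ k) * (G * K ^ k)"
    unfolding T_def abs_mult
    by (intro mult_mono shifted_series_bound[OF \<alpha>] shifted_series_bound[OF \<beta>]) (use assms G_nonneg K in auto)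
  then show ?thesis by (simp add: power2_eq_square power_mult_distrib mult_ac)
qed

text \<open>Product rule for differences: since the arguments are halved, each factor contributes
  \<open>\<eta> / 2\<close>.\<close>

lemma T_perturb:
  assumes "\<bar>a - 1\<bar> \<le> \<eta>" "\<bar>b - 1\<bar> \<le> \<eta>" "\<eta> \<le> 1"
  shows "\<bar>T k a b - T k 1 1\<bar> \<le> G\<^sup>2 * (K\<^sup>2) ^ k * \<eta>"
proof -
  let ?A = "shifted_series \<alpha> k" and ?B = "shifted_series \<beta> k"
  have ab: "\<bar>a / 2\<bar> \<le> 1" "\<bar>b / 2\<bar> \<le> 1" "\<bar>1 / 2 :: real\<bar> \<le> 1" using assms by auto
  have ab': "\<bar>a / 2 - 1 / 2\<bar> \<le> \<eta> / 2" "\<bar>b / 2 - 1 / 2\<bar> \<le> \<eta> / 2" using assms by linarith+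
  have 1: "\<bar>?A (a / 2) - ?A (1 / 2)\<bar> \<le> G * K ^ k * (\<eta> / 2)"
    by (rule order_trans[OF shifted_series_lipschitz[OF \<alpha> ab(1,3)] mult_left_mono[OF ab'(1)]]) (use G_nonneg K in auto)
  have 2: "\<bar>?B (b / 2) - ?B (1 / 2)\<bar> \<le> G * K ^ k * (\<eta> / 2)"
    by (rule order_trans[OF shifted_series_lipschitz[OF \<beta> ab(2,3)] mult_left_mono[OF ab'(2)]]) (use G_nonneg K in auto)
  have "T k a b - T k 1 1 = (?A (a / 2) - ?A (1 / 2)) * ?B (b / 2) + ?A (1 / 2) * (?B (b / 2) - ?B (1 / 2))"
    by (simp add: T_def algebra_simps)
  also have "\<bar>\<dots>\<bar> \<le> \<bar>?A (a / 2) - ?A (1 / 2)\<bar> * \<bar>?B (b / 2)\<bar> + \<bar>?A (1 / 2)\<bar> * \<bar>?B (b / 2) - ?B (1 / 2)\<bar>"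
    by (rule order_trans[OF abs_triangle_ineq]) (simp add: abs_mult)
  also have "\<dots> \<le> (G * K ^ k * (\<eta> / 2)) * (G * K ^ k) + (G * K ^ k) * (G * K ^ k * (\<eta> / 2))"
    by (intro add_mono mult_mono 1 2 shifted_series_bound[OF \<alpha>] shifted_series_bound[OF \<beta>])
       (use assms G_nonneg K ab in auto)
  also have "\<dots> = G\<^sup>2 * (K\<^sup>2) ^ k * \<eta>"
    by (simp add: power2_eq_square power_mult_distrib mult_ac)
  finally show ?thesis .
qed

text \<open>The common majorant of both covariance estimates: \<open>4 ^ k\<close> absorbs powers of
  variances and covariances up to 2, and dropping \<open>k = 0\<close> subtracts 1.\<close>

lemma exp_tail_sums:
  "(\<lambda>k. R * ((4 * K\<^sup>2) ^ Suc k / fact (Suc k))) sums (R * (exp (4 * K\<^sup>2) - 1))" for R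
proof -
  have "(\<lambda>k. (4 * K\<^sup>2) ^ k / fact k) sums exp (4 * K\<^sup>2)"
    by (intro has_sum_imp_sums exp_has_sum_real)
  then have "(\<lambda>k. (4 * K\<^sup>2) ^ (k + 1) / fact (k + 1)) sums (exp (4 * K\<^sup>2) - (\<Sum>i<1. (4 * K\<^sup>2) ^ i / fact i))"
    by (rule sums_split_initial_segment)
  then show ?thesis by (intro sums_mult) simp
qed

text \<open>Each term changes through \<open>a ^ k\<close> and through \<open>T\<close>; both
  changes are at most \<open>\<eta>\<close> times the majorant, hence the factor 2.\<close>

lemma covariance_diag_estimate:
  assumes a: "\<bar>a - 1\<bar> \<le> \<eta>" and \<eta>: "\<eta> \<le> 1"
    and S: "(\<lambda>k. a ^ Suc k / fact (Suc k) * T (Suc k) a a) sums S"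
    and S1: "(\<lambda>k. T (Suc k) 1 1 / fact (Suc k)) sums S1"
  shows "\<bar>S - S1\<bar> \<le> 2 * \<eta> * G\<^sup>2 * (exp (4 * K\<^sup>2) - 1)"
proof (rule sums_abs_le[OF sums_diff[OF S S1] exp_tail_sums])
  fix n :: nat
  define k where "k = Suc n"
  have \<eta>0: "\<eta> \<ge> 0" using a by linarith
  \<comment> \<open>\<open>a\<close> may exceed 1, so the power difference is estimated for
    \<open>a / 2\<close> and \<open>1 / 2\<close>, inside the unit interval, and then rescaled by
    \<open>2 ^ k\<close>.\<close>
  have "\<bar>(a / 2) ^ k - (1 / 2) ^ k\<bar> \<le> real k * \<bar>a / 2 - 1 / 2\<bar>"
    using norm_power_diff[of "a / 2" "1 / 2" k] a \<eta> by simp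
  also have "\<dots> \<le> 2 ^ k * \<eta>"
  proof (rule mult_mono)
    show "\<bar>a / 2 - 1 / 2\<bar> \<le> \<eta>" using a by linarith
  qed (auto simp: less_imp_le[OF of_nat_less_two_power])
  finally have "2 ^ k * \<bar>(a / 2) ^ k - (1 / 2) ^ k\<bar> \<le> 2 ^ k * (2 ^ k * \<eta>)"
    by (intro mult_left_mono) auto
  moreover have "2 ^ k * \<bar>(a / 2) ^ k - (1 / 2) ^ k\<bar> = \<bar>a ^ k - 1\<bar>"
  proof -
    have "a ^ k - 1 = 2 ^ k * ((a / 2) ^ k - (1 / 2) ^ k)"
      by (simp add: power_divide right_diff_distrib)
    then show ?thesis by (simp only: abs_mult power_abs abs_numeral)
  qed
  moreover have "2 ^ k * (2 ^ k * \<eta>) = 4 ^ k * \<eta>"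
    by (simp add: power_mult_distrib[symmetric])
  ultimately have p: "\<bar>a ^ k - 1\<bar> \<le> 4 ^ k * \<eta>" by simp
  have "\<bar>a ^ k * T k a a - T k 1 1\<bar> = \<bar>(a ^ k - 1) * T k a a + (T k a a - T k 1 1)\<bar>"
    by (simp add: algebra_simps)
  also have "\<dots> \<le> \<bar>a ^ k - 1\<bar> * \<bar>T k a a\<bar> + \<bar>T k a a - T k 1 1\<bar>"
    by (rule order_trans[OF abs_triangle_ineq]) (simp add: abs_mult)
  also have "\<dots> \<le> 4 ^ k * \<eta> * (G\<^sup>2 * (K\<^sup>2) ^ k) + G\<^sup>2 * (K\<^sup>2) ^ k * \<eta>"
    by (intro add_mono mult_mono p T_bound T_perturb a \<eta>) (use a \<eta> \<eta>0 in auto)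
  also have "\<dots> \<le> 4 ^ k * \<eta> * (G\<^sup>2 * (K\<^sup>2) ^ k) + 4 ^ k * (G\<^sup>2 * (K\<^sup>2) ^ k * \<eta>)"
  proof (rule add_left_mono)
    have "1 * (G\<^sup>2 * (K\<^sup>2) ^ k * \<eta>) \<le> 4 ^ k * (G\<^sup>2 * (K\<^sup>2) ^ k * \<eta>)"
      by (rule mult_right_mono) (use \<eta>0 in auto)
    then show "G\<^sup>2 * (K\<^sup>2) ^ k * \<eta> \<le> 4 ^ k * (G\<^sup>2 * (K\<^sup>2) ^ k * \<eta>)" by (simp only: mult_1_left)
  qed
  also have "\<dots> = 2 * \<eta> * G\<^sup>2 * (4 * K\<^sup>2) ^ k"
    unfolding power_mult_distrib by algebra
  finally have *: "\<bar>a ^ k * T k a a - T k 1 1\<bar> / fact k \<le> 2 * \<eta> * G\<^sup>2 * (4 * K\<^sup>2) ^ k / fact k"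
    by (intro divide_right_mono) auto
  have "\<bar>a ^ k / fact k * T k a a - T k 1 1 / fact k\<bar> = \<bar>a ^ k * T k a a - T k 1 1\<bar> / fact k"
    by (simp add: diff_divide_distrib[symmetric] abs_divide)
  with * show "\<bar>a ^ Suc n / fact (Suc n) * T (Suc n) a a - T (Suc n) 1 1 / fact (Suc n)\<bar>
      \<le> 2 * \<eta> * G\<^sup>2 * ((4 * K\<^sup>2) ^ Suc n / fact (Suc n))"
    unfolding k_def by (simp only: times_divide_eq_right)
qed

text \<open>Applied with \<open>c\<close> an off-diagonal entry of the inverse and \<open>d\<close>
  the entry of \<open>B\<close>. The term \<open>k = 1\<close> matches \<open>- d * T 1 1 1\<close>
  up to order \<open>\<eta>\<close>; every later term contains \<open>c\<^sup>2\<close>.\<close>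

lemma covariance_off_diag_estimate:
  assumes a: "\<bar>a - 1\<bar> \<le> \<eta>" and b: "\<bar>b - 1\<bar> \<le> \<eta>" and \<eta>: "\<eta> \<le> 1"
    and c: "\<bar>c + d\<bar> \<le> \<eta>" "\<bar>c\<bar> \<le> 2" "c\<^sup>2 \<le> 4 * \<eta>"
    and S: "(\<lambda>k. c ^ Suc k / fact (Suc k) * T (Suc k) a b) sums S"
  shows "\<bar>S + d * T 1 1 1\<bar> \<le> 4 * \<eta> * G\<^sup>2 * (exp (4 * K\<^sup>2) - 1)"
\<comment> \<open>The correction is written as a series supported at index 0, so that one termwise
  comparison covers everything.\<close>
proof (rule sums_abs_le[OF sums_add[OF S sums_single[of 0 "\<lambda>_. d * T 1 1 1"]] exp_tail_sums])
  fix n :: nat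
  have \<eta>0: "\<eta> \<ge> 0" using a by linarith
  have ab: "\<bar>a\<bar> \<le> 2" "\<bar>b\<bar> \<le> 2" using a b \<eta> by auto
  show "\<bar>c ^ Suc n / fact (Suc n) * T (Suc n) a b + (if n = 0 then d * T 1 1 1 else 0)\<bar>
    \<le> 4 * \<eta> * G\<^sup>2 * ((4 * K\<^sup>2) ^ Suc n / fact (Suc n))"
  proof (cases n)
    case 0
    have "\<bar>c * T 1 a b + d * T 1 1 1\<bar> = \<bar>c * (T 1 a b - T 1 1 1) + (c + d) * T 1 1 1\<bar>"
      by (simp add: algebra_simps)
    also have "\<dots> \<le> \<bar>c\<bar> * \<bar>T 1 a b - T 1 1 1\<bar> + \<bar>c + d\<bar> * \<bar>T 1 1 1\<bar>"
      by (rule order_trans[OF abs_triangle_ineq]) (simp add: abs_mult)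
    also have "\<dots> \<le> 2 * (G\<^sup>2 * (K\<^sup>2) ^ 1 * \<eta>) + \<eta> * (G\<^sup>2 * (K\<^sup>2) ^ 1)"
      by (intro add_mono mult_mono c T_bound T_perturb a b \<eta>) (use \<eta>0 in auto)
    also have "\<dots> \<le> 4 * \<eta> * G\<^sup>2 * (4 * K\<^sup>2)"
      using \<eta>0 mult_nonneg_nonneg[of \<eta> "G\<^sup>2 * K\<^sup>2"] by (simp add: algebra_simps)
    finally show ?thesis using 0 by simp
  next
    case (Suc m)
    \<comment> \<open>The exponent is \<open>m + 2\<close>, so a full square can be split
      off.\<close>
    have "\<bar>c\<bar> ^ Suc n = c\<^sup>2 * \<bar>c\<bar> ^ m" by (simp add: Suc power2_eq_square)
    also have "\<dots> \<le> (4 * \<eta>) * 2 ^ m"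
      by (intro mult_mono c power_mono) (use \<eta>0 in auto)
    also have "\<dots> \<le> (4 * \<eta>) * 4 ^ Suc n"
    proof (rule mult_left_mono)
      have "(2::real) ^ m \<le> 4 ^ m" by (intro power_mono) auto
      also have "\<dots> \<le> 4 ^ Suc n" by (intro power_increasing) (auto simp: Suc)
      finally show "(2::real) ^ m \<le> 4 ^ Suc n" .
    qed (use \<eta>0 in auto)
    finally have "\<bar>c\<bar> ^ Suc n * \<bar>T (Suc n) a b\<bar> \<le> (4 * \<eta>) * 4 ^ Suc n * (G\<^sup>2 * (K\<^sup>2) ^ Suc n)"
      by (intro mult_mono T_bound ab) (use \<eta>0 in auto)
    also have "\<dots> = 4 * \<eta> * G\<^sup>2 * (4 * K\<^sup>2) ^ Suc n"
      by (simp only: power_mult_distrib mult_ac)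
    finally have "\<bar>c\<bar> ^ Suc n * \<bar>T (Suc n) a b\<bar> / fact (Suc n) \<le> 4 * \<eta> * G\<^sup>2 * (4 * K\<^sup>2) ^ Suc n / fact (Suc n)"
      by (rule divide_right_mono) simp
    moreover have "\<bar>c ^ Suc n / fact (Suc n) * T (Suc n) a b\<bar> = \<bar>c\<bar> ^ Suc n * \<bar>T (Suc n) a b\<bar> / fact (Suc n)"
      by (simp only: abs_mult abs_divide power_abs abs_of_nonneg[OF fact_ge_zero] times_divide_eq_left)
    ultimately show ?thesis using Suc by (simp only: times_divide_eq_right nat.distinct if_False add_0_right)
  qed
qed

end

section \<open>Covariance entries and the operator norm of the error\<close>

lemma borel_measurable_smooth_fun:
  assumes "smooth_fun g"
  shows "g \<in> borel_measurable borel"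
proof -
  have "\<forall>x. g differentiable (at x)"
    using assms unfolding smooth_fun_def hderiv_def by (metis funpow_0)
  then show ?thesis
    by (intro borel_measurable_continuous_onI continuous_at_imp_continuous_on ballI differentiable_imp_continuous_within) auto
qed

context symmetric_contraction
begin

lemma mat_1_plus_B: "mat 1 + B = P 1" by (simp add: P_def)

lemma coercive_P1: "coercive (P 1)" by (rule coercive_P) simp

text \<open>Using \<open>y = e - B *v y\<close> twice leaves the exact remainder
  \<open>B *v (B *v y)\<close>, and \<open>y\<close> has norm at most 4.\<close>

lemma \<Gamma>_expansion: "\<bar>\<Gamma> 1 $ i $ j - (of_bool (i = j) - B $ i $ j)\<bar> \<le> 4 * \<delta>\<^sup>2"
proof -
  let ?e = "axis j 1 :: real^'n"
  let ?y = "\<Gamma> 1 *v ?e"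
  have "P 1 *v ?y = ?e"
    by (simp add: \<Gamma>_def matrix_vector_mul_assoc coercive_inv[OF coercive_P1])
  then have y: "?e - ?y = B *v ?y" by (simp add: P_mult algebra_simps)
  have "?y - (?e - B *v ?e) = B *v ?e - (?e - ?y)" by simp
  also have "\<dots> = B *v (?e - ?y)" by (simp only: matrix_vector_mult_diff_distrib) (simp only: y)
  finally have eq: "?y - (?e - B *v ?e) = B *v (B *v ?y)" unfolding y .
  have "\<Gamma> 1 $ i $ j - (of_bool (i = j) - B $ i $ j) = (?y - (?e - B *v ?e)) $ i"
    by (simp add: matrix_vector_mult_basis column_def) (simp add: axis_def)
  then have "\<bar>\<Gamma> 1 $ i $ j - (of_bool (i = j) - B $ i $ j)\<bar> \<le> norm (B *v (B *v ?y))"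
    unfolding eq by (simp add: component_le_norm_cart)
  also have "\<dots> \<le> \<delta> * (\<delta> * (4 * norm ?e))"
    by (intro order_trans[OF contr] mult_left_mono norm_\<Gamma> \<delta>) auto
  finally show ?thesis by (simp add: power2_eq_square norm_axis_1 mult_ac)
qed

lemma B_entry: "\<bar>B $ i $ j\<bar> \<le> \<delta>"
proof -
  have "\<bar>B $ i $ j\<bar> = \<bar>(B *v axis j 1) $ i\<bar>"
    by (simp add: matrix_vector_mult_basis column_def)
  also have "\<dots> \<le> norm (B *v axis j 1)" by (rule component_le_norm_cart)
  also have "\<dots> \<le> \<delta>" using contr[of "axis j 1"] by (simp add: norm_axis_1)
  finally show ?thesis .
qed

text \<open>By \<open>gauss_mass_det\<close> the constant in the density is the reciprocal of the
  mass.\<close>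

lemma gauss_prec_integral:
  fixes h :: "real^'n \<Rightarrow> real"
  assumes [measurable]: "h \<in> borel_measurable borel"
  shows "(\<integral>x. h x \<partial>gauss_prec (P 1)) = (\<integral>x. h x \<partial>gauss_kernel_measure (P 1)) / gauss_mass (P 1)"
proof -
  let ?m = "gauss_mass (P 1)" and ?D = "det (P 1)"
  have Q: "?m\<^sup>2 * ?D = (2 * pi) ^ CARD('n)"
    using gauss_mass_det by (simp add: P_def)
  have m: "?m \<ge> 0" using mass_nonneg[of 1] by (simp add: mass_def)
  \<comment> \<open>Positivity of the determinant and non-vanishing of the mass both come from the
    positive value of this product.\<close>
  have "?m\<^sup>2 * ?D > 0" unfolding Q by simp
  then have D: "?D > 0" and m0: "?m \<noteq> 0" by (auto simp: zero_less_mult_iff)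
  have "?m * sqrt ?D = sqrt ((2 * pi) ^ CARD('n))"
    unfolding Q[symmetric] using m by (simp add: real_sqrt_mult)
  also have "\<dots> = ((2 * pi) powr real CARD('n)) powr (1 / 2)"
    by (subst powr_realpow) (auto simp: powr_half_sqrt)
  also have "\<dots> = (2 * pi) powr (real CARD('n) / 2)"
    by (simp only: powr_powr) simp
  finally have c: "(2 * pi) powr (- real CARD('n) / 2) * sqrt ?D = 1 / ?m"
    using m0 by (simp add: powr_minus field_simps)
  have den: "gauss_prec_density (P 1) x = gauss_kernel (P 1) x / ?m" for x
    by (simp only: gauss_prec_density_def c gauss_kernel_def times_divide_eq_left mult_1_left)
  have "(\<integral>x. h x \<partial>gauss_prec (P 1)) = (\<integral>x. gauss_kernel (P 1) x / ?m * h x \<partial>lborel)"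
    unfolding gauss_prec_def den
    by (subst integral_density) (use m in \<open>auto simp: less_imp_le[OF gauss_kernel_pos]\<close>)
  also have "\<dots> = (\<integral>x. h x * gauss_kernel (P 1) x / ?m \<partial>lborel)" by (simp add: mult.commute)
  also have "\<dots> = (\<integral>x. h x \<partial>gauss_kernel_measure (P 1)) / ?m"
    by (simp add: gauss_kernel_measure_integral)
  finally show ?thesis .
qed

lemma gauss_mass_P1_nonzero: "gauss_mass (P 1) \<noteq> 0"
  using gauss_mass_det by (auto simp: P_def)

lemma gauss_prec_expectation_sums:
  fixes \<alpha> \<beta> :: "nat \<Rightarrow> real"
  assumes \<alpha>: "\<And>m. \<bar>\<alpha> m\<bar> \<le> C * K ^ m" and \<beta>: "\<And>n. \<bar>\<beta> n\<bar> \<le> C * K ^ n" and K: "K \<ge> 0"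
    and F: "\<And>x. (\<lambda>m. \<alpha> m / fact m * x ^ m) sums F x"
    and G: "\<And>x. (\<lambda>n. \<beta> n / fact n * x ^ n) sums G x"
    and [measurable]: "F \<in> borel_measurable borel" "G \<in> borel_measurable borel"
  shows "(\<lambda>k. \<Gamma> 1 $ i $ j ^ k / fact k * (shifted_series \<alpha> k (\<Gamma> 1 $ i $ i / 2) * shifted_series \<beta> k (\<Gamma> 1 $ j $ j / 2)))
    sums (\<integral>x. F (x$i) * G (x$j) \<partial>gauss_prec (P 1))"
proof -
  let ?N = "gauss_kernel_measure (P 1)" and ?m = "gauss_mass (P 1)"
  define t where "t k = \<Gamma> 1 $ i $ j ^ k / fact k *
    (shifted_series \<alpha> k (\<Gamma> 1 $ i $ i / 2) * shifted_series \<beta> k (\<Gamma> 1 $ j $ j / 2))" for k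
  have m: "(\<lambda>x. x$k) \<in> borel_measurable ?N" for k :: 'n
    unfolding gauss_kernel_measure_def by simp
  have "((\<lambda>k. ?m * t k) has_sum (\<integral>x. F (x$i) * G (x$j) \<partial>?N)) UNIV"
    unfolding t_def \<Gamma>_def
    by (rule gauss_expectation_has_sum[OF m m gauss_pair_mgf[OF coercive_P1] \<alpha> \<beta> K F G])
  then have "(\<lambda>k. ?m * t k / ?m) sums ((\<integral>x. F (x$i) * G (x$j) \<partial>?N) / ?m)"
    by (intro sums_divide has_sum_imp_sums)
  then have "t sums ((\<integral>x. F (x$i) * G (x$j) \<partial>?N) / ?m)"
    using gauss_mass_P1_nonzero by simp
  also have "(\<integral>x. F (x$i) * G (x$j) \<partial>?N) / ?m = (\<integral>x. F (x$i) * G (x$j) \<partial>gauss_prec (P 1))"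
    by (subst gauss_prec_integral) simp_all
  finally show ?thesis by (simp only: t_def[abs_def])
qed

text \<open>A mean is the expectation of a product with the constant 1. The coefficients of 1 vanish
  beyond index 0, so only \<open>k = 0\<close> survives; \<open>C \<ge> 1\<close> lets them share
  the bound of \<open>\<alpha>\<close>.\<close>

lemma gauss_prec_mean:
  fixes \<alpha> :: "nat \<Rightarrow> real"
  assumes \<alpha>: "\<And>m. \<bar>\<alpha> m\<bar> \<le> C * K ^ m" and K: "K \<ge> 0" and C: "C \<ge> 1"
    and F: "\<And>x. (\<lambda>m. \<alpha> m / fact m * x ^ m) sums F x"
    and Fm: "F \<in> borel_measurable borel"
  shows "(\<integral>x. F (x$i) \<partial>gauss_prec (P 1)) = shifted_series \<alpha> 0 (\<Gamma> 1 $ i $ i / 2)"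
proof -
  define \<beta> :: "nat \<Rightarrow> real" where "\<beta> n = of_bool (n = 0)" for n
  have b: "\<bar>\<beta> n\<bar> \<le> C * K ^ n" for n using C K by (auto simp: \<beta>_def)
  have s: "(\<lambda>n. \<beta> n / fact n * x ^ n) sums 1" for x :: real
  proof -
    have "(\<lambda>n. \<beta> n / fact n * x ^ n) = (\<lambda>n. if n = 0 then x ^ n / fact n else 0)"
      by (rule ext) (simp add: \<beta>_def)
    then show ?thesis using sums_single[of 0 "\<lambda>n. x ^ n / fact n"] by simp
  qed
  have sb: "shifted_series \<beta> k x = of_bool (k = 0)" for k x
  proof -
    have "(\<lambda>u. \<beta> (2 * u + k) / fact u * x ^ u) = (\<lambda>u. if u = 0 then of_bool (k = 0) else 0)"
      by (rule ext) (simp add: \<beta>_def)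
    then show ?thesis
      unfolding shifted_series_def using sums_unique[OF sums_single[of 0 "\<lambda>_. of_bool (k = 0) :: real"]] by simp
  qed
  have "(\<lambda>k. \<Gamma> 1 $ i $ i ^ k / fact k * (shifted_series \<alpha> k (\<Gamma> 1 $ i $ i / 2) * shifted_series \<beta> k (\<Gamma> 1 $ i $ i / 2)))
    sums (\<integral>x. F (x$i) * 1 \<partial>gauss_prec (P 1))"
    by (rule gauss_prec_expectation_sums[OF \<alpha> b K F s Fm]) simp
  also have "(\<lambda>k. \<Gamma> 1 $ i $ i ^ k / fact k * (shifted_series \<alpha> k (\<Gamma> 1 $ i $ i / 2) * shifted_series \<beta> k (\<Gamma> 1 $ i $ i / 2)))
     = (\<lambda>k. if k = 0 then shifted_series \<alpha> k (\<Gamma> 1 $ i $ i / 2) else 0)"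
    by (rule ext) (simp add: sb)
  finally have "(\<lambda>k. if k = 0 then shifted_series \<alpha> k (\<Gamma> 1 $ i $ i / 2) else 0) sums (\<integral>x. F (x$i) \<partial>gauss_prec (P 1))"
    by simp
  then show ?thesis by (rule sums_unique2) (rule sums_single)
qed

text \<open>The term \<open>k = 0\<close> of the product expectation is exactly the product of the
  means, so subtracting it starts the series at 1.\<close>

lemma covariance_sums:
  fixes f :: "'n \<Rightarrow> real \<Rightarrow> real"
  defines "\<alpha> \<equiv> \<lambda>i a. hderiv a (f i) 0"
  assumes smooth: "\<And>i. smooth_fun (f i)"
    and bound: "\<And>i m. \<bar>\<alpha> i m\<bar> \<le> C * K ^ m" and K: "K \<ge> 0" and C: "C \<ge> 1"
    and taylor: "\<And>i x. (\<lambda>m. \<alpha> i m / fact m * x ^ m) sums f i x"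
  shows "(\<lambda>k. \<Gamma> 1 $ i $ j ^ Suc k / fact (Suc k) *
      (shifted_series (\<alpha> i) (Suc k) (\<Gamma> 1 $ i $ i / 2) * shifted_series (\<alpha> j) (Suc k) (\<Gamma> 1 $ j $ j / 2)))
    sums (cov_transformed (P 1) f $ i $ j)"
proof -
  let ?t = "\<lambda>k. \<Gamma> 1 $ i $ j ^ k / fact k * (shifted_series (\<alpha> i) k (\<Gamma> 1 $ i $ i / 2) * shifted_series (\<alpha> j) k (\<Gamma> 1 $ j $ j / 2))"
  note meas = borel_measurable_smooth_fun[OF smooth]
  have "?t sums (\<integral>x. f i (x$i) * f j (x$j) \<partial>gauss_prec (P 1))"
    by (rule gauss_prec_expectation_sums[OF bound bound K taylor taylor meas meas])
  then have "(\<lambda>k. ?t (k + 1)) sums ((\<integral>x. f i (x$i) * f j (x$j) \<partial>gauss_prec (P 1)) - (\<Sum>k<1. ?t k))"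
    by (rule sums_split_initial_segment)
  also have "(\<Sum>k<1. ?t k) = (\<integral>x. f i (x$i) \<partial>gauss_prec (P 1)) * (\<integral>x. f j (x$j) \<partial>gauss_prec (P 1))"
    by (simp add: gauss_prec_mean[OF bound K C taylor meas])
  finally show ?thesis by (simp add: cov_transformed_def)
qed

text \<open>The constant 16 is the 4 of the off-diagonal estimate times the 4 in
  \<open>\<eta>\<close>; the diagonal bound is weakened to match.\<close>

lemma covariance_entry_estimate:
  fixes f :: "'n \<Rightarrow> real \<Rightarrow> real"
  assumes smooth: "\<And>i. smooth_fun (f i)"
    and bound: "\<And>i m. \<bar>hderiv m (f i) 0\<bar> \<le> C * K ^ m" and K: "K \<ge> 1" and C: "C \<ge> 1"
    and taylor: "\<And>i x. (\<lambda>m. hderiv m (f i) 0 / fact m * x ^ m) sums f i x"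
    and diag: "\<And>i. B $ i $ i = 0"
  shows "\<bar>(cov_transformed (mat 1 + B) f - diag_mat (\<lambda>i. kappa (f i))
      + diag_mat (\<lambda>i. lambda (f i)) ** B ** diag_mat (\<lambda>i. lambda (f i))) $ i $ j\<bar>
    \<le> 16 * (C * exp (2 * K\<^sup>2))\<^sup>2 * (exp (4 * K\<^sup>2) - 1) * \<delta>\<^sup>2"
proof -
  define \<alpha> where "\<alpha> i a = hderiv a (f i) 0" for i a
  interpret exp_type_pair "\<alpha> i" "\<alpha> j" C K
    by unfold_locales (use bound K in \<open>auto simp: \<alpha>_def\<close>)
  have K0: "K \<ge> 0" using K by simp
  \<comment> \<open>The error of the first-order expansion of the inverse;
    \<open>\<delta> < 1 / 2\<close> keeps it at most 1.\<close>
  define \<eta> where "\<eta> = 4 * \<delta>\<^sup>2"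
  have "\<delta> * \<delta> \<le> 1 / 2 * (1 / 2)" by (intro mult_mono) (use \<delta> in auto)
  then have \<eta>: "0 \<le> \<eta>" "\<eta> \<le> 1" by (auto simp: \<eta>_def power2_eq_square)
  have a: "\<bar>\<Gamma> 1 $ k $ k - 1\<bar> \<le> \<eta>" for k
    using \<Gamma>_expansion[of k k] diag[of k] by (simp add: \<eta>_def)
  have S: "(\<lambda>k. \<Gamma> 1 $ i $ j ^ Suc k / fact (Suc k) * T (Suc k) (\<Gamma> 1 $ i $ i) (\<Gamma> 1 $ j $ j))
      sums (cov_transformed (mat 1 + B) f $ i $ j)"
    unfolding T_def \<alpha>_def mat_1_plus_B
    by (rule covariance_sums[OF smooth bound K0 C taylor])
  have E: "0 \<le> exp (4 * K\<^sup>2) - 1" by simp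
  have LBL: "(diag_mat (\<lambda>i. lambda (f i)) ** B ** diag_mat (\<lambda>i. lambda (f i))) $ p $ q =
      lambda (f p) * B $ p $ q * lambda (f q)" for p q
    by (simp add: matrix_matrix_mult_def diag_mat_def if_distrib[of "\<lambda>x. x * _"] if_distrib[of "\<lambda>x. _ * x"] cong: if_cong)
  have D: "diag_mat v $ p $ q = (if p = q then v p else 0)" for v p q
    by (simp add: diag_mat_def)
  have lam: "lambda (f k) = shifted_series (\<alpha> k) 1 (1 / 2)" for k
    by (simp add: lambda_def Fser_def shifted_series_def \<alpha>_def)
  show ?thesis
  proof (cases "i = j")
    case True
    have kap: "kappa (f i) = (\<Sum>k. T (Suc k) 1 1 / fact (Suc k))"
      unfolding T_def unfolding kappa_def Fser_def shifted_series_def \<alpha>_def power2_eq_square True by simp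
    have "(\<lambda>k. T (Suc k) 1 1 / fact (Suc k)) sums kappa (f i)"
      unfolding kap
    proof (rule summable_sums, rule summable_comparison_test'[OF sums_summable[OF exp_tail_sums[of "G\<^sup>2"]]])
      fix k :: nat
      have "\<bar>T (Suc k) 1 1\<bar> \<le> G\<^sup>2 * (K\<^sup>2) ^ Suc k" by (rule T_bound) auto
      also have "\<dots> \<le> G\<^sup>2 * (4 * K\<^sup>2) ^ Suc k" by (intro mult_left_mono power_mono) auto
      finally show "norm (T (Suc k) 1 1 / fact (Suc k)) \<le> G\<^sup>2 * ((4 * K\<^sup>2) ^ Suc k / fact (Suc k))"
        by (simp add: divide_right_mono del: power_Suc fact_Suc)
    qed
    then have "\<bar>cov_transformed (mat 1 + B) f $ i $ j - kappa (f i)\<bar> \<le> 2 * \<eta> * G\<^sup>2 * (exp (4 * K\<^sup>2) - 1)"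
      using covariance_diag_estimate[OF a \<eta>(2)] S True by simp
    also have "\<dots> \<le> 4 * \<eta> * G\<^sup>2 * (exp (4 * K\<^sup>2) - 1)"
      by (intro mult_right_mono E) (use \<eta> in auto)
    finally show ?thesis
      using True diag by (simp add: LBL D \<eta>_def G_def mult_ac)
  next
    case False
    let ?c = "\<Gamma> 1 $ i $ j"
    have c: "\<bar>?c + B $ i $ j\<bar> \<le> \<eta>" using \<Gamma>_expansion[of i j] False by (simp add: \<eta>_def)
    \<comment> \<open>Hence the covariance entry is at most \<open>3 * \<delta>\<close> in size, and
      its square at most \<open>9 * \<delta>\<^sup>2\<close>, below
      \<open>4 * \<eta>\<close>.\<close>
    have "\<eta> \<le> 2 * \<delta>" using mult_left_mono[of \<delta> "1 / 2" "4 * \<delta>"] \<delta> by (simp add: \<eta>_def power2_eq_square)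
    then have c3: "\<bar>?c\<bar> \<le> 3 * \<delta>" using c B_entry[of i j] by linarith
    have "\<bar>?c\<bar>\<^sup>2 \<le> (3 * \<delta>)\<^sup>2" by (intro power_mono c3) auto
    also have "\<dots> \<le> 4 * \<eta>" by (simp add: \<eta>_def power_mult_distrib)
    finally have c2: "?c\<^sup>2 \<le> 4 * \<eta>" by simp
    have "\<bar>cov_transformed (mat 1 + B) f $ i $ j + B $ i $ j * T 1 1 1\<bar> \<le> 4 * \<eta> * G\<^sup>2 * (exp (4 * K\<^sup>2) - 1)"
      by (rule covariance_off_diag_estimate[OF a a \<eta>(2) c _ c2 S]) (use c3 \<delta> in auto)
    then show ?thesis
      using False by (simp add: LBL D) (simp add: lam T_def \<eta>_def G_def mult_ac)
  qed
qed

end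

text \<open>Derivative bounds at 0 do not detect a flat summand such as exp (-1/x^2), which does
  change the covariance; \<open>taylor\<close> identifies each function with its Taylor series. The
  constant is chosen before \<open>B\<close> and \<open>\<delta>\<close>.\<close>

theorem theorem5:
  fixes f :: "'n::finite \<Rightarrow> real \<Rightarrow> real"
  assumes smooth: "\<And>i. smooth_fun (f i)"
    and dbound: "\<And>i. \<exists>C K. \<forall>a. \<bar>hderiv a (f i) 0\<bar> \<le> C * K ^ a"
    and taylor: "\<And>i x. (\<lambda>a. hderiv a (f i) 0 / fact a * x ^ a) sums f i x"
  shows "\<exists>C. \<forall>(B :: real^'n^'n) (\<delta> :: real).
           transpose B = B \<and> (\<forall>i. B $ i $ i = 0) \<and> opnorm B \<le> \<delta> \<and> \<delta> < 1/2 \<longrightarrow>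
           opnorm (cov_transformed (mat 1 + B) f
                   - diag_mat (\<lambda>i. kappa (f i))
                   + diag_mat (\<lambda>i. lambda (f i)) ** B ** diag_mat (\<lambda>i. lambda (f i)))
             \<le> C * (\<delta> / (1 - \<delta>))\<^sup>2"
proof -
  obtain C0 K0 where b0: "\<And>i a. \<bar>hderiv a (f i) 0\<bar> \<le> C0 i * K0 i ^ a"
    using dbound by metis
  \<comment> \<open>One pair of constants for all indices; the added 1 gives the lower bounds
    \<open>C \<ge> 1\<close> and \<open>K \<ge> 1\<close>.\<close>
  define C where "C = 1 + (\<Sum>i\<in>UNIV. \<bar>C0 i\<bar>)"
  define K where "K = 1 + (\<Sum>i\<in>UNIV. \<bar>K0 i\<bar>)"
  have C: "C \<ge> 1" and K: "K \<ge> 1" by (auto simp: C_def K_def sum_nonneg)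
  have bound: "\<bar>hderiv a (f i) 0\<bar> \<le> C * K ^ a" for i a
  proof -
    have "\<bar>C0 i\<bar> \<le> C" "\<bar>K0 i\<bar> \<le> K"
      using member_le_sum[of i UNIV "\<lambda>i. \<bar>C0 i\<bar>"] member_le_sum[of i UNIV "\<lambda>i. \<bar>K0 i\<bar>"]
      by (auto simp: C_def K_def)
    then have "\<bar>C0 i\<bar> * \<bar>K0 i\<bar> ^ a \<le> C * K ^ a"
      using C by (intro mult_mono power_mono) auto
    moreover have "C0 i * K0 i ^ a \<le> \<bar>C0 i\<bar> * \<bar>K0 i\<bar> ^ a"
      by (metis abs_ge_self abs_mult power_abs)
    ultimately show ?thesis using b0[of a i] by linarith
  qed
  define R where "R = 16 * (C * exp (2 * K\<^sup>2))\<^sup>2 * (exp (4 * K\<^sup>2) - 1)"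
  have R: "R \<ge> 0" by (simp add: R_def)
  show ?thesis
  proof (intro exI[of _ "real CARD('n) * (real CARD('n) * R)"] allI impI, elim conjE)
    fix B :: "real^'n^'n" and \<delta> :: real
    assume sym: "transpose B = B" and diag: "\<forall>i. B $ i $ i = 0" and op: "opnorm B \<le> \<delta>" and \<delta>: "\<delta> < 1 / 2"
    have \<delta>0: "0 \<le> \<delta>"
      using op onorm_pos_le[OF matrix_vector_mul_bounded_linear[of B]] by (simp add: opnorm_def)
    interpret symmetric_contraction B \<delta>
    proof
      fix x
      have "norm (B *v x) \<le> opnorm B * norm x"
        unfolding opnorm_def by (rule onorm[OF matrix_vector_mul_bounded_linear])
      also have "\<dots> \<le> \<delta> * norm x" by (intro mult_right_mono op) simp
      finally show "norm (B *v x) \<le> \<delta> * norm x" .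
    qed (use sym \<delta> \<delta>0 in auto)
    let ?E = "cov_transformed (mat 1 + B) f - diag_mat (\<lambda>i. kappa (f i))
      + diag_mat (\<lambda>i. lambda (f i)) ** B ** diag_mat (\<lambda>i. lambda (f i))"
    \<comment> \<open>The operator norm is at most the sum of the absolute entries, which costs the
      square of the dimension.\<close>
    have "opnorm ?E \<le> (\<Sum>i\<in>UNIV. \<Sum>j\<in>UNIV. \<bar>?E $ i $ j\<bar>)"
      unfolding opnorm_def by (rule onorm_le_matrix_component_sum)
    also have "\<dots> \<le> (\<Sum>i\<in>(UNIV :: 'n set). \<Sum>j\<in>(UNIV :: 'n set). R * \<delta>\<^sup>2)"
      unfolding R_def
      by (intro sum_mono covariance_entry_estimate[OF smooth bound K C taylor]) (use diag in auto)
    also have "\<dots> = real CARD('n) * (real CARD('n) * R) * \<delta>\<^sup>2" by simp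
    also have "\<dots> \<le> real CARD('n) * (real CARD('n) * R) * (\<delta> / (1 - \<delta>))\<^sup>2"
    proof (intro mult_left_mono power_mono)
      show "\<delta> \<le> \<delta> / (1 - \<delta>)"
        using \<delta> \<delta>0 mult_left_mono[of "1 - \<delta>" 1 \<delta>] by (simp add: pos_le_divide_eq)
    qed (use R \<delta>0 in auto)
    finally show "opnorm ?E \<le> real CARD('n) * (real CARD('n) * R) * (\<delta> / (1 - \<delta>))\<^sup>2" .
  qed
qed

end
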